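(* Consider first-order span-respecting primal-dual algorithms for solving convex quadratic programs (QPs) in the primal-dual form $\min_x\max_{y\ge 0}\ \mathcal L(x,y)=\frac12x^TQx+c^Tx+y^TAx-b^Ty$. (i) There exists a QP instance such that any span-respecting algorithm requires at least $$\Omega\left(\min_{\xi>0}\left\{\max\left\{\frac{\|A\|}{\alpha_\xi},\frac{\|A\|}{\xi}\right\}\right\}\log\frac1\epsilon\right)$$ iterations to find an $\epsilon$-accurate solution, in the sense that the distance to optimality is no larger than $\epsilon$. (ii) There exists a QP instance such that any span-respecting algorithm requires at least $$\Omega\left(\min_{\xi>0}\left\{\max\left\{\sqrt{\frac{\|Q\|}{\alpha_\xi}},\sqrt{\frac{\|Q\|}{\xi}}\right\}\right\}\log\frac1\epsilon\right)$$ iterations to find an $\epsilon$-accurate solution, in the sense that the distance to optimality is no larger than $\epsilon$.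
   Context: The data are $Q\in\mathbb R^{n\times n}$ with $Q\succeq0$, $A\in\mathbb R^{m\times n}$, $b\in\mathbb R^m$, $c\in\mathbb R^n$; the saddle point problem above is the primal-dual formulation of $\min_{x\in\mathbb R^n}\frac12x^TQx+c^Tx$ subject to $Ax\le b$. Write $z=(x,y)$, let $\mathcal Z$ be the set of feasible primal-dual pairs ($\mathbb R^n\times\mathbb R^m_+$, or $\mathbb R^n\times\mathbb R^m$ when the dual variable is free), and let $\mathcal Z^*$ be the set of optimal solutions (saddle points). $\|\cdot\|$ is the Euclidean norm for vectors and the spectral norm for matrices. The distance to optimality of $z$ is $\mathrm{dist}(z,\mathcal Z^* )=\min_{z'\in\mathcal Z^*}\|z-z'\|$. Smoothed duality gap: for $\xi\ge0$ and $z=(x,y),\dot z\in\mathcal Z$, $$G_\xi(z;\dot z)=\max_{\hat z=(\hat x,\hat y)\in\mathcal Z}\left\{\mathcal L(x,\hat y)-\mathcal L(\hat x,y)-\frac\xi2\|\hat z-\dot z\|^2\right\}.$$ Quadratic growth: for $\xi>0$, the smoothed duality gap satisfies quadratic growth on a set $\mathbb S$ with constant $\alpha_\xi>0$ if $G_\xi(z;z^* )\ge\alpha_\xi\,\mathrm{dist}^2(z,\mathcal Z^* )$ for all $z^*\in\mathcal Z^*$ and all $z\in\mathbb S$. In the theorem, $\alpha_\xi$ denotes the quadratic growth constant of the instance in this sense. Span-respecting: a primal-dual algorithm is called first-order span-respecting for an unconstrained problem $\min_{x\in\mathbb R^n}\max_{y\in\mathbb R^m}\mathcal L(x,y)$ if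 its iterates satisfy $$x^k\in x^0+\mathrm{Span}\{\nabla_x\mathcal L(x^i,y^j):\ \forall i,j\in\{0,\dots,k-1\}\},$$ $$y^k\in y^0+\mathrm{Span}\{\nabla_y\mathcal L(x^i,y^j):\ \forall i\in\{0,\dots,k\},\ \forall j\in\{0,\dots,k-1\}\}.$$ Since this notion is defined for problems without constraints on $x$ and $y$, the QP instances meant are ones with free dual variable $y\in\mathbb R^m$ (the primal-dual form of a QP with equality constraints). *)

theory Defs
  imports
    "HOL-Analysis.Derivative"
    "HOL-Library.Extended_Real"
    "Jordan_Normal_Form.VS_Connect"
begin

no_notation inner (infix \<open>\<bullet>\<close> 70)

definition vnorm :: "real vec \<Rightarrow> real" where
  "vnorm v = sqrt (v \<bullet> v)"

definition spectral_norm :: "real mat \<Rightarrow> real" where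
  "spectral_norm M = (SUP v \<in> {v \<in> carrier_vec (dim_col M). vnorm v \<le> 1}. vnorm (M *\<^sub>v v))"

definition psd :: "real mat \<Rightarrow> bool" where
  "psd M \<longleftrightarrow> transpose_mat M = M \<and> (\<forall>v \<in> carrier_vec (dim_col M). 0 \<le> v \<bullet> (M *\<^sub>v v))"

record qp =
  qmat :: "real mat"
  amat :: "real mat"
  bvec :: "real vec"
  cvec :: "real vec"

definition qp_instance :: "nat \<Rightarrow> nat \<Rightarrow> qp \<Rightarrow> bool" where
  "qp_instance n m P \<longleftrightarrow>
     qmat P \<in> carrier_mat n n \<and> psd (qmat P) \<and> amat P \<in> carrier_mat m n \<and>
     bvec P \<in> carrier_vec m \<and> cvec P \<in> carrier_vec n"

abbreviation nvars :: "qp \<Rightarrow> nat" where "nvars P \<equiv> dim_vec (cvec P)"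
abbreviation ncons :: "qp \<Rightarrow> nat" where "ncons P \<equiv> dim_vec (bvec P)"

definition lagrangian :: "qp \<Rightarrow> real vec \<Rightarrow> real vec \<Rightarrow> real" where
  "lagrangian P x y =
     1 / 2 * (x \<bullet> (qmat P *\<^sub>v x)) + cvec P \<bullet> x + y \<bullet> (amat P *\<^sub>v x) - bvec P \<bullet> y"

text \<open>The dual variable is free, so primal-dual pairs are only restricted in their dimensions.\<close>

definition feasible :: "qp \<Rightarrow> (real vec \<times> real vec) set" where
  "feasible P = carrier_vec (nvars P) \<times> carrier_vec (ncons P)"

definition saddle_points :: "qp \<Rightarrow> (real vec \<times> real vec) set" where
  "saddle_points P = {(x, y) \<in> feasible P. \<forall>(x', y') \<in> feasible P.
     lagrangian P x y' \<le> lagrangian P x y \<and> lagrangian P x y \<le> lagrangian P x' y}"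

definition pdist :: "real vec \<times> real vec \<Rightarrow> real vec \<times> real vec \<Rightarrow> real" where
  "pdist z z' = sqrt ((vnorm (fst z - fst z'))\<^sup>2 + (vnorm (snd z - snd z'))\<^sup>2)"

definition opt_dist :: "qp \<Rightarrow> real vec \<times> real vec \<Rightarrow> real" where
  "opt_dist P z = (INF z' \<in> saddle_points P. pdist z z')"

text \<open>The gap is extended-real valued because the maximum may be infinite for \<open>\<xi> = 0\<close>.\<close>

definition smoothed_gap ::
    "qp \<Rightarrow> real \<Rightarrow> real vec \<times> real vec \<Rightarrow> real vec \<times> real vec \<Rightarrow> ereal" where
  "smoothed_gap P \<xi> z zdot = (SUP zhat \<in> feasible P.
     ereal (lagrangian P (fst z) (snd zhat) - lagrangian P (fst zhat) (snd z)
       - \<xi> / 2 * (pdist zhat zdot)\<^sup>2))"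

definition quadratic_growth ::
    "qp \<Rightarrow> real \<Rightarrow> (real vec \<times> real vec) set \<Rightarrow> real \<Rightarrow> bool" where
  "quadratic_growth P \<xi> S \<alpha> \<longleftrightarrow>
     0 < \<alpha> \<and> (\<forall>zstar \<in> saddle_points P. \<forall>z \<in> S.
       ereal (\<alpha> * (opt_dist P z)\<^sup>2) \<le> smoothed_gap P \<xi> z zstar)"

text \<open>
  The sharp constant on the whole space. It is meaningful only if some growth constant exists
  and some feasible point is not optimal; otherwise the supremum is over an empty or an
  unbounded set.
\<close>

definition growth_constant :: "qp \<Rightarrow> real \<Rightarrow> real" where
  "growth_constant P \<xi> = Sup {\<alpha>. quadratic_growth P \<xi> (feasible P) \<alpha>}"

definition grad :: "nat \<Rightarrow> (real vec \<Rightarrow> real) \<Rightarrow> real vec \<Rightarrow> real vec" where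
  "grad n f v = vec n (\<lambda>i. deriv (\<lambda>t. f (v + t \<cdot>\<^sub>v unit_vec n i)) 0)"

definition grad_x :: "qp \<Rightarrow> real vec \<Rightarrow> real vec \<Rightarrow> real vec" where
  "grad_x P x y = grad (nvars P) (\<lambda>u. lagrangian P u y) x"

definition grad_y :: "qp \<Rightarrow> real vec \<Rightarrow> real vec \<Rightarrow> real vec" where
  "grad_y P x y = grad (ncons P) (\<lambda>u. lagrangian P x u) y"

abbreviation vspan :: "nat \<Rightarrow> real vec set \<Rightarrow> real vec set" where
  "vspan n \<equiv> LinearCombinations.module.span class_ring (module_vec TYPE(real) n)"

text \<open>
  A run of an algorithm is represented by its sequences of iterates \<open>xs\<close> and \<open>ys\<close>; for
  \<open>k = 0\<close> both spans are generated by the empty set.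
\<close>

definition span_respecting :: "qp \<Rightarrow> (nat \<Rightarrow> real vec) \<Rightarrow> (nat \<Rightarrow> real vec) \<Rightarrow> bool" where
  "span_respecting P xs ys \<longleftrightarrow>
     xs 0 \<in> carrier_vec (nvars P) \<and> ys 0 \<in> carrier_vec (ncons P) \<and>
     (\<forall>k. xs k \<in> {xs 0 + d | d.
        d \<in> vspan (nvars P) {grad_x P (xs i) (ys j) | i j. i < k \<and> j < k}}) \<and>
     (\<forall>k. ys k \<in> {ys 0 + d | d.
        d \<in> vspan (ncons P) {grad_y P (xs i) (ys j) | i j. i \<le> k \<and> j < k}})"

end

theory Submission
  imports Defs
begin

text \<open>
  Let \<open>M\<close> be lower bidiagonal with diagonal \<open>1\<close> and subdiagonal \<open>- q\<close>. Its singular values lie in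
  \<open>[1 - q, 1 + q]\<close>, and the solution \<open>w\<close> of \<open>M w = c e\<^sub>0\<close> is the geometric sequence \<open>c q\<^sup>i\<close>. Started at
  distance \<open>w\<close> from the optimum, a span-respecting algorithm activates at most one new coordinate per
  iteration, so after \<open>k\<close> iterations the tail of \<open>w\<close> from \<open>k\<close> on is still missing and the error is
  of order \<open>q\<^sup>k\<close>. For (i) take the Lagrangian \<open>(y - y\<^sub>0) \<bullet> M (x - x\<^sub>0 - w)\<close>, whose growth constant is
  \<open>(1 - q)\<^sup>2 / (2 \<xi>)\<close>; for (ii) take the objective \<open>|M (x - x\<^sub>0 - w)|\<^sup>2 / 2\<close> without constraints
  (\<open>A = 0\<close>), whose growth constant is \<open>(1 - q)\<^sup>2 / 2\<close>. In both cases the complexity measure equals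
  \<open>\<kappa> = sqrt 2 (1 + q) / (1 - q)\<close>, and \<open>ln (1 / q)\<close> is of order \<open>1 / \<kappa>\<close>.
\<close>

no_notation vec_nth (infixl \<open>$\<close> 90)

subsection \<open>Vectors, gradients and growth constants\<close>

lemma vnorm_sq: "(vnorm v)\<^sup>2 = v \<bullet> v"
  unfolding vnorm_def scalar_prod_def by (simp add: sum_nonneg)

lemma vnorm_sq_sum: "(vnorm v)\<^sup>2 = (\<Sum>i<dim_vec v. (v $ i)\<^sup>2)"
  unfolding vnorm_sq scalar_prod_def by (simp add: power2_eq_square atLeast0LessThan)

lemma vnorm_nonneg [simp]: "0 \<le> vnorm v"
  unfolding vnorm_def scalar_prod_def by (simp add: sum_nonneg)

lemma vnorm_zero [simp]: "vnorm (0\<^sub>v n) = 0"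
  unfolding vnorm_def by simp

lemma vnorm_eq_0_iff:
  assumes "v \<in> carrier_vec n"
  shows "vnorm v = 0 \<longleftrightarrow> v = 0\<^sub>v n"
proof
  assume "vnorm v = 0"
  then have "(\<Sum>i<dim_vec v. (v $ i)\<^sup>2) = 0"
    using vnorm_sq_sum[of v] by simp
  then show "v = 0\<^sub>v n"
    using assms by (subst (asm) sum_nonneg_eq_0_iff) (auto intro!: eq_vecI)
qed (use assms in simp)

lemma vnorm_smult: "vnorm (c \<cdot>\<^sub>v v) = \<bar>c\<bar> * vnorm v"
proof -
  have "(vnorm (c \<cdot>\<^sub>v v))\<^sup>2 = (\<bar>c\<bar> * vnorm v)\<^sup>2"
    by (simp add: vnorm_sq_sum power_mult_distrib sum_distrib_left)
  then show ?thesis by (simp only: power2_eq_iff_nonneg vnorm_nonneg abs_ge_zero mult_nonneg_nonneg)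
qed

lemma vnorm_unit_vec [simp]: "i < n \<Longrightarrow> vnorm (unit_vec n i) = 1"
  unfolding vnorm_def by simp

lemma vnorm_uminus [simp]: "vnorm (- v) = vnorm v"
  unfolding vnorm_def by simp

lemma vnorm_minus_self [simp]: "vnorm (v - v) = 0"
  unfolding vnorm_def scalar_prod_def by simp

lemma pdist_sq: "(pdist z z')\<^sup>2 = (vnorm (fst z - fst z'))\<^sup>2 + (vnorm (snd z - snd z'))\<^sup>2"
  unfolding pdist_def by simp

lemma vec_add_diff_cancel [simp]:
  fixes a v :: "real vec"
  assumes "a \<in> carrier_vec n" "v \<in> carrier_vec n"
  shows "a + v - a = v"
  using assms by (intro eq_vecI) auto

lemma vec_diff_eq_0_iff:
  fixes a v :: "real vec"
  assumes "a \<in> carrier_vec n" "v \<in> carrier_vec n"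
  shows "a - v = 0\<^sub>v n \<longleftrightarrow> a = v"
  using assms by (auto simp: vec_eq_iff)

lemma zero_mult_mat_vec:
  fixes v :: "real vec"
  assumes "v \<in> carrier_vec n"
  shows "0\<^sub>m k n *\<^sub>v v = 0\<^sub>v k"
  using assms by (intro eq_vecI) auto

text \<open>Completing the square in every coordinate: the difference of the two sides is a sum of
  terms \<open>(\<xi> * v $ i - w $ i)^2 / (2 * \<xi>)\<close>. It bounds each of the two concave
  maximizations into which the bilinear smoothed gap splits.\<close>

lemma scalar_prod_young:
  assumes "v \<in> carrier_vec n" "w \<in> carrier_vec n" and xi: "0 < \<xi>"
  shows "v \<bullet> w - \<xi> / 2 * (vnorm v)\<^sup>2 \<le> (vnorm w)\<^sup>2 / (2 * \<xi>)"
proof -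
  have "v \<bullet> w - \<xi> / 2 * (vnorm v)\<^sup>2 = (\<Sum>i<n. v $ i * w $ i - \<xi> / 2 * (v $ i)\<^sup>2)"
    using assms by (simp add: scalar_prod_def vnorm_sq_sum sum_subtractf sum_distrib_left atLeast0LessThan)
  also have "\<dots> \<le> (\<Sum>i<n. (w $ i)\<^sup>2 / (2 * \<xi>))"
  proof (rule sum_mono)
    fix i
    have "0 \<le> (\<xi> * v $ i - w $ i)\<^sup>2 / (2 * \<xi>)" using xi by simp
    also have "\<dots> = (w $ i)\<^sup>2 / (2 * \<xi>) - (v $ i * w $ i - \<xi> / 2 * (v $ i)\<^sup>2)"
      using xi by (simp add: field_simps power2_eq_square)
    finally show "v $ i * w $ i - \<xi> / 2 * (v $ i)\<^sup>2 \<le> (w $ i)\<^sup>2 / (2 * \<xi>)" by simp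
  qed
  also have "\<dots> = (vnorm w)\<^sup>2 / (2 * \<xi>)"
    using assms by (simp add: vnorm_sq_sum sum_divide_distrib)
  finally show ?thesis .
qed

text \<open>Along each coordinate line \<open>f\<close> is a polynomial of degree at most two, so
  its derivative at 0 is the linear coefficient. The quadratic coefficient \<open>r i\<close> may
  vary with the direction.\<close>

lemma grad_eqI:
  assumes g: "g \<in> carrier_vec n"
    and f: "\<And>i t. i < n \<Longrightarrow> f (v + t \<cdot>\<^sub>v unit_vec n i) = a + t * g $ i + t\<^sup>2 * r i"
  shows "grad n f v = g"
proof (rule eq_vecI)
  fix i assume i: "i < dim_vec g"
  then have "i < n" using g by simp
  have "((\<lambda>t. a + t * g $ i + t\<^sup>2 * r i) has_real_derivative g $ i) (at 0)"
    by (auto intro!: derivative_eq_intros)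
  then show "grad n f v $ i = g $ i"
    using \<open>i < n\<close> by (simp add: grad_def f DERIV_imp_deriv)
qed (use g in \<open>simp add: grad_def\<close>)

lemma transpose_scalar_prod:
  fixes A :: "real mat"
  assumes "A \<in> carrier_mat m n" "x \<in> carrier_vec n" "y \<in> carrier_vec m"
  shows "(transpose_mat A *\<^sub>v y) \<bullet> x = y \<bullet> (A *\<^sub>v x)"
  using transpose_vec_mult_scalar[of A m n x y] assms by simp

text \<open>The Lagrangian is expanded along coordinate lines. The symmetry contained in
  \<open>psd\<close> merges the two cross terms of the quadratic form into one.\<close>

lemma grad_lagrangian:
  assumes P: "qp_instance n m P" and x: "x \<in> carrier_vec n" and y: "y \<in> carrier_vec m"
  shows "grad_x P x y = qmat P *\<^sub>v x + cvec P + transpose_mat (amat P) *\<^sub>v y"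
    and "grad_y P x y = amat P *\<^sub>v x - bvec P"
proof -
  let ?Q = "qmat P" and ?A = "amat P" and ?b = "bvec P" and ?c = "cvec P"
  have [simp]: "?Q \<in> carrier_mat n n" "?A \<in> carrier_mat m n" "?b \<in> carrier_vec m" "?c \<in> carrier_vec n"
    and sym: "transpose_mat ?Q = ?Q"
    using P unfolding qp_instance_def psd_def by auto
  have n: "dim_vec ?c = n" and m: "dim_vec ?b = m"
    by (simp_all only: carrier_vecD[OF \<open>?b \<in> _\<close>] carrier_vecD[OF \<open>?c \<in> _\<close>])
  have [simp]: "dim_row ?Q = n" "dim_col ?Q = n" "dim_row ?A = m" "dim_col ?A = n" "dim_vec x = n" "dim_vec y = m"
    using carrier_matD[OF \<open>?Q \<in> _\<close>] carrier_matD[OF \<open>?A \<in> _\<close>] x y by simp_all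
  note [simp] = x y
  let ?g = "?Q *\<^sub>v x + ?c + transpose_mat ?A *\<^sub>v y"
  have Qx[simp]: "?Q *\<^sub>v u \<in> carrier_vec n" if "u \<in> carrier_vec n" for u
    using that by (intro mult_mat_vec_carrier[of _ n n]) auto
  have Ax[simp]: "?A *\<^sub>v u \<in> carrier_vec m" if "u \<in> carrier_vec n" for u
    using that by (intro mult_mat_vec_carrier[of _ m n]) auto
  have Ay[simp]: "transpose_mat ?A *\<^sub>v u \<in> carrier_vec n" if "u \<in> carrier_vec m" for u
    using that by (intro mult_mat_vec_carrier[of _ n m]) auto
  have g: "?g \<in> carrier_vec n" by simp
  have "lagrangian P (x + t \<cdot>\<^sub>v unit_vec n i) y =
      lagrangian P x y + t * ?g $ i + t\<^sup>2 * (1 / 2 * (unit_vec n i \<bullet> (?Q *\<^sub>v unit_vec n i)))"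
    if i: "i < n" for i t
  proof -
    let ?e = "unit_vec n i :: real vec"
    have 1: "?Q *\<^sub>v (x + t \<cdot>\<^sub>v ?e) = ?Q *\<^sub>v x + t \<cdot>\<^sub>v (?Q *\<^sub>v ?e)"
      by (simp add: mult_add_distrib_mat_vec[of _ n n] mult_mat_vec[of _ n n])
    have 2: "?A *\<^sub>v (x + t \<cdot>\<^sub>v ?e) = ?A *\<^sub>v x + t \<cdot>\<^sub>v (?A *\<^sub>v ?e)"
      by (simp add: mult_add_distrib_mat_vec[of _ m n] mult_mat_vec[of _ m n])
    have 3: "x \<bullet> (?Q *\<^sub>v ?e) = (?Q *\<^sub>v x) $ i"
      using transpose_scalar_prod[of ?Q n n ?e x] i by (simp add: sym)
    have 4: "?e \<bullet> (?Q *\<^sub>v x) = (?Q *\<^sub>v x) $ i"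
      using i by (simp add: scalar_prod_left_unit[of _ n])
    have 5: "y \<bullet> (?A *\<^sub>v ?e) = (transpose_mat ?A *\<^sub>v y) $ i"
      using transpose_scalar_prod[of ?A m n ?e y] i by simp
    have Q: "(x + t \<cdot>\<^sub>v ?e) \<bullet> (?Q *\<^sub>v (x + t \<cdot>\<^sub>v ?e)) =
       x \<bullet> (?Q *\<^sub>v x) + 2 * t * (?Q *\<^sub>v x) $ i + t\<^sup>2 * (?e \<bullet> (?Q *\<^sub>v ?e))"
      unfolding 1
      by (simp add: add_scalar_prod_distrib[of _ n] scalar_prod_add_distrib[of _ n] 3 4
          del: scalar_prod_left_unit scalar_prod_right_unit) (simp add: algebra_simps power2_eq_square)
    have C: "?c \<bullet> (x + t \<cdot>\<^sub>v ?e) = ?c \<bullet> x + t * ?c $ i"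
      using i by (simp add: scalar_prod_add_distrib[of _ n])
    have A: "y \<bullet> (?A *\<^sub>v (x + t \<cdot>\<^sub>v ?e)) = y \<bullet> (?A *\<^sub>v x) + t * (transpose_mat ?A *\<^sub>v y) $ i"
      unfolding 2 by (simp add: scalar_prod_add_distrib[of _ m] 5)
    have "?g $ i = (?Q *\<^sub>v x) $ i + ?c $ i + (transpose_mat ?A *\<^sub>v y) $ i"
      using i by (simp add: n)
    then show ?thesis
      unfolding lagrangian_def Q C A by (simp add: algebra_simps)
  qed
  from grad_eqI[OF g this] show "grad_x P x y = ?g"
    unfolding grad_x_def n by simp
  let ?h = "?A *\<^sub>v x - ?b"
  have h: "?h \<in> carrier_vec m" by simp
  have "lagrangian P x (y + t \<cdot>\<^sub>v unit_vec m i) = lagrangian P x y + t * ?h $ i + t\<^sup>2 * 0"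
    if i: "i < m" for i t
  proof -
    let ?e = "unit_vec m i :: real vec"
    have B: "?b \<bullet> (y + t \<cdot>\<^sub>v ?e) = ?b \<bullet> y + t * ?b $ i"
      using i by (simp add: scalar_prod_add_distrib[of _ m])
    have A: "(y + t \<cdot>\<^sub>v ?e) \<bullet> (?A *\<^sub>v x) = y \<bullet> (?A *\<^sub>v x) + t * (?A *\<^sub>v x) $ i"
      using i by (simp add: add_scalar_prod_distrib[of _ m])
    have h_i: "?h $ i = (?A *\<^sub>v x) $ i - ?b $ i"
      using i by (simp add: m)
    show ?thesis
      unfolding lagrangian_def B A h_i by (simp add: algebra_simps)
  qed
  from grad_eqI[OF h this] show "grad_y P x y = ?h"
    unfolding grad_y_def m by simp
qed

text \<open>Vanishing of one coordinate is a linear condition, so spans inherit it. This is what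
  keeps untouched coordinates of the iterates at their initial values.\<close>

lemma span_coordinate_eq_0:
  assumes "S \<subseteq> carrier_vec n" "j < n" "\<And>v. v \<in> S \<Longrightarrow> v $ j = 0" "d \<in> vspan n S"
  shows "d $ j = 0"
proof -
  interpret vec_space "TYPE(real)" n .
  obtain a U where U: "finite U" "U \<subseteq> S" "d = lincomb a U"
    using assms(4) unfolding span_def by auto
  then have "d $ j = (\<Sum>v\<in>U. a v * v $ j)"
    using assms by (simp add: lincomb_index subset_trans)
  also have "\<dots> = 0"
    using U assms(3) by (intro sum.neutral) auto
  finally show ?thesis .
qed

lemma span_vec_carrier:
  assumes "S \<subseteq> carrier_vec n" "d \<in> vspan n S"
  shows "d \<in> carrier_vec n"
proof -
  interpret vec_space "TYPE(real)" n .
  show ?thesis using assms span_closed by auto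
qed

section \<open>Exact values of smoothed gaps, growth constants and spectral norms\<close>

lemma saddle_pointsD:
  assumes "(x, y) \<in> saddle_points P" "(x', y') \<in> feasible P"
  shows "lagrangian P x y' \<le> lagrangian P x y" "lagrangian P x y \<le> lagrangian P x' y"
  using assms unfolding saddle_points_def by fast+

lemma smoothed_gap_eqI:
  assumes "zhat \<in> feasible P"
    and "lagrangian P (fst z) (snd zhat) - lagrangian P (fst zhat) (snd z) - \<xi> / 2 * (pdist zhat zdot)\<^sup>2 = g"
    and "\<And>x y. (x, y) \<in> feasible P \<Longrightarrow>
      lagrangian P (fst z) y - lagrangian P x (snd z) - \<xi> / 2 * (pdist (x, y) zdot)\<^sup>2 \<le> g"
  shows "smoothed_gap P \<xi> z zdot = ereal g"
proof (rule antisym)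
  show "smoothed_gap P \<xi> z zdot \<le> ereal g"
    unfolding smoothed_gap_def using assms(3) by (intro SUP_least) (auto simp: case_prod_beta)
  show "ereal g \<le> smoothed_gap P \<xi> z zdot"
    unfolding smoothed_gap_def using assms(1,2) by (intro SUP_upper2[of zhat]) auto
qed

text \<open>A single point at distance 1 whose gap equals \<open>a\<close> rules out every larger
  constant, so the supremum is a maximum and is known exactly.\<close>

lemma growth_constant_eqI:
  assumes growth: "quadratic_growth P \<xi> (feasible P) a"
    and tight: "zs \<in> saddle_points P" "z \<in> feasible P" "opt_dist P z = 1"
      "smoothed_gap P \<xi> z zs = ereal a"
  shows "growth_constant P \<xi> = a"
  unfolding growth_constant_def
proof (rule cSup_eq_maximum)
  fix a' assume "a' \<in> {\<alpha>. quadratic_growth P \<xi> (feasible P) \<alpha>}"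
  then have "ereal (a' * (opt_dist P z)\<^sup>2) \<le> smoothed_gap P \<xi> z zs"
    using tight(1,2) unfolding quadratic_growth_def by blast
  then show "a' \<le> a" using tight by simp
qed (use growth in simp)

lemma spectral_norm_eqI:
  assumes M: "dim_col M = n"
    and bound: "\<And>v. v \<in> carrier_vec n \<Longrightarrow> vnorm (M *\<^sub>v v) \<le> L * vnorm v"
    and h: "h \<in> carrier_vec n" "vnorm h = 1" "vnorm (M *\<^sub>v h) = L"
  shows "spectral_norm M = L"
  unfolding spectral_norm_def
proof (rule cSup_eq_maximum)
  have L: "0 \<le> L" using h(3) vnorm_nonneg[of "M *\<^sub>v h"] by simp
  show "L \<in> (\<lambda>v. vnorm (M *\<^sub>v v)) ` {v \<in> carrier_vec (dim_col M). vnorm v \<le> 1}"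
    using h M by (intro image_eqI[of _ _ h]) auto
  fix t assume "t \<in> (\<lambda>v. vnorm (M *\<^sub>v v)) ` {v \<in> carrier_vec (dim_col M). vnorm v \<le> 1}"
  then obtain v where v: "v \<in> carrier_vec n" "vnorm v \<le> 1" "t = vnorm (M *\<^sub>v v)"
    using M by auto
  have "t \<le> L * vnorm v" using bound v by simp
  also have "\<dots> \<le> L" using v L by (simp add: mult_left_le)
  finally show "t \<le> L" .
qed

subsection \<open>Two families of quadratic programs with prescribed saddle points\<close>

text \<open>The linear terms are chosen so that the Lagrangian is
  \<open>(y - ys) \<bullet> (A *\<^sub>v (x - xs))\<close> up to a constant.\<close>

definition bilinear_qp :: "nat \<Rightarrow> real mat \<Rightarrow> real vec \<Rightarrow> real vec \<Rightarrow> qp" where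
  "bilinear_qp n A xs ys = \<lparr>qmat = 0\<^sub>m n n, amat = A, bvec = A *\<^sub>v xs, cvec = - (transpose_mat A *\<^sub>v ys)\<rparr>"

text \<open>The objective is half the squared norm of \<open>A *\<^sub>v (x - xs)\<close> up to a
  constant. The single zero constraint keeps the number of constraints positive while the dual
  variable has no effect on the Lagrangian.\<close>

definition least_squares_qp :: "nat \<Rightarrow> real mat \<Rightarrow> real vec \<Rightarrow> qp" where
  "least_squares_qp n A xs = \<lparr>qmat = transpose_mat A * A, amat = 0\<^sub>m 1 n, bvec = 0\<^sub>v 1,
     cvec = - (transpose_mat A *\<^sub>v (A *\<^sub>v xs))\<rparr>"

text \<open>
  \<open>u\<close> and \<open>h\<close> witness that \<open>s\<close> and \<open>L\<close> are the extreme singular values, which makes the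
  growth constants and spectral norms exact.
\<close>

locale bounded_below_matrix =
  fixes n :: nat and A :: "real mat" and s L :: real and u h :: "real vec"
  assumes A [simp]: "A \<in> carrier_mat n n"
    and s_pos: "0 < s"
    and lower: "v \<in> carrier_vec n \<Longrightarrow> s * vnorm v \<le> vnorm (A *\<^sub>v v)"
    and lower_transpose: "v \<in> carrier_vec n \<Longrightarrow> s * vnorm v \<le> vnorm (transpose_mat A *\<^sub>v v)"
    and upper: "v \<in> carrier_vec n \<Longrightarrow> vnorm (A *\<^sub>v v) \<le> L * vnorm v"
    and upper_transpose: "v \<in> carrier_vec n \<Longrightarrow> vnorm (transpose_mat A *\<^sub>v v) \<le> L * vnorm v"
    and u: "u \<in> carrier_vec n" "vnorm u = 1" "vnorm (A *\<^sub>v u) = s"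
    and h: "h \<in> carrier_vec n" "vnorm h = 1" "A *\<^sub>v h = L \<cdot>\<^sub>v h" "transpose_mat A *\<^sub>v h = L \<cdot>\<^sub>v h"
begin

lemma dims [simp]: "dim_row A = n" "dim_col A = n"
  by (rule carrier_matD[OF A])+

lemma mult_carrier [simp]:
  "v \<in> carrier_vec n \<Longrightarrow> A *\<^sub>v v \<in> carrier_vec n"
  "v \<in> carrier_vec n \<Longrightarrow> transpose_mat A *\<^sub>v v \<in> carrier_vec n"
  by (auto intro: mult_mat_vec_carrier[of _ n n])

lemma L_pos: "0 < L"
proof -
  have "s \<le> L" using lower[of h] upper[of h] h by simp
  then show ?thesis using s_pos by simp
qed

lemma spectral_norm_A: "spectral_norm A = L"
  using upper h L_pos by (intro spectral_norm_eqI[of _ n _ h]) (auto simp: vnorm_smult)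

lemma gram_mult:
  assumes "v \<in> carrier_vec n"
  shows "(transpose_mat A * A) *\<^sub>v v = transpose_mat A *\<^sub>v (A *\<^sub>v v)"
  using assms by (intro assoc_mult_mat_vec[of _ n n _ n]) auto

text \<open>Two upper bounds in succession give \<open>L * L\<close>, and \<open>h\<close> attains
  it because it is an eigenvector of both factors with eigenvalue \<open>L\<close>.\<close>

lemma spectral_norm_gram: "spectral_norm (transpose_mat A * A) = L\<^sup>2"
proof (intro spectral_norm_eqI[of _ n _ h])
  show "vnorm ((transpose_mat A * A) *\<^sub>v v) \<le> L\<^sup>2 * vnorm v" if v: "v \<in> carrier_vec n" for v
  proof -
    have "vnorm ((transpose_mat A * A) *\<^sub>v v) \<le> L * vnorm (A *\<^sub>v v)"
      unfolding gram_mult[OF v] using v by (intro upper_transpose) simp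
    also have "\<dots> \<le> L * (L * vnorm v)"
      using L_pos upper[OF v] by simp
    finally show ?thesis by (simp add: power2_eq_square)
  qed
  have "(transpose_mat A * A) *\<^sub>v h = L \<cdot>\<^sub>v (L \<cdot>\<^sub>v h)"
    unfolding gram_mult[OF h(1)] h(3) using h by (simp add: mult_mat_vec[of _ n n])
  then show "vnorm ((transpose_mat A * A) *\<^sub>v h) = L\<^sup>2"
    using h L_pos by (simp add: vnorm_smult power2_eq_square)
qed (use h in auto)

lemma mult_eq_0_iff:
  assumes "v \<in> carrier_vec n"
  shows "vnorm (A *\<^sub>v v) = 0 \<longleftrightarrow> v = 0\<^sub>v n" "vnorm (transpose_mat A *\<^sub>v v) = 0 \<longleftrightarrow> v = 0\<^sub>v n"
proof -
  have *: "vnorm v = 0" if "s * vnorm v \<le> 0"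
    using that s_pos vnorm_nonneg[of v] by (simp add: mult_le_0_iff)
  have "A *\<^sub>v 0\<^sub>v n = 0\<^sub>v n" "transpose_mat A *\<^sub>v 0\<^sub>v n = 0\<^sub>v n" by auto
  then show "vnorm (A *\<^sub>v v) = 0 \<longleftrightarrow> v = 0\<^sub>v n" "vnorm (transpose_mat A *\<^sub>v v) = 0 \<longleftrightarrow> v = 0\<^sub>v n"
    using * lower[OF assms] lower_transpose[OF assms] vnorm_eq_0_iff[OF assms] by auto
qed

section \<open>The bilinear family: gap, growth constant and complexity measure\<close>

context
  fixes xs ys :: "real vec"
  assumes xs [simp]: "xs \<in> carrier_vec n" and ys [simp]: "ys \<in> carrier_vec n"
begin

abbreviation "BP \<equiv> bilinear_qp n A xs ys"

lemma bilinear_qp_instance: "qp_instance n n BP"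
  unfolding qp_instance_def bilinear_qp_def psd_def by (auto simp: zero_mult_mat_vec simp del: carrier_dim_vec)

lemma bilinear_feasible: "feasible BP = carrier_vec n \<times> carrier_vec n"
  unfolding feasible_def bilinear_qp_def by simp

lemma bilinear_lagrangian:
  assumes [simp]: "x \<in> carrier_vec n" "y \<in> carrier_vec n"
  shows "lagrangian BP x y = (y - ys) \<bullet> (A *\<^sub>v (x - xs)) - ys \<bullet> (A *\<^sub>v xs)"
proof -
  have "(y - ys) \<bullet> (A *\<^sub>v (x - xs)) = y \<bullet> (A *\<^sub>v x) - ys \<bullet> (A *\<^sub>v x) - (y \<bullet> (A *\<^sub>v xs) - ys \<bullet> (A *\<^sub>v xs))"
    by (simp add: mult_minus_distrib_mat_vec[of _ n n] minus_scalar_prod_distrib[of _ n] scalar_prod_minus_distrib[of _ n])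
  moreover have "x \<bullet> (0\<^sub>m n n *\<^sub>v x) = 0"
    by (simp add: zero_mult_mat_vec)
  moreover have "(- (transpose_mat A *\<^sub>v ys)) \<bullet> x = - (ys \<bullet> (A *\<^sub>v x))"
    using transpose_scalar_prod[of A n n x ys] by (simp add: carrier_vecD[OF assms(1)])
  moreover have "(A *\<^sub>v xs) \<bullet> y = y \<bullet> (A *\<^sub>v xs)"
    by (rule comm_scalar_prod[of _ n]) auto
  ultimately show ?thesis
    unfolding lagrangian_def bilinear_qp_def by simp
qed

lemma bilinear_grad:
  assumes x: "x \<in> carrier_vec n" and y: "y \<in> carrier_vec n"
  shows "grad_x BP x y = transpose_mat A *\<^sub>v (y - ys)" and "grad_y BP x y = A *\<^sub>v (x - xs)"
proof -
  have "0\<^sub>m n n *\<^sub>v x + - (transpose_mat A *\<^sub>v ys) + transpose_mat A *\<^sub>v y = transpose_mat A *\<^sub>v y - transpose_mat A *\<^sub>v ys"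
    unfolding zero_mult_mat_vec[OF x] by (intro eq_vecI) auto
  then show "grad_x BP x y = transpose_mat A *\<^sub>v (y - ys)"
    unfolding grad_lagrangian(1)[OF bilinear_qp_instance x y]
    using y by (simp add: bilinear_qp_def mult_minus_distrib_mat_vec[of _ n n])
  show "grad_y BP x y = A *\<^sub>v (x - xs)"
    unfolding grad_lagrangian(2)[OF bilinear_qp_instance x y]
    using x by (simp add: bilinear_qp_def mult_minus_distrib_mat_vec[of _ n n])
qed

lemma bilinear_saddle_points: "saddle_points BP = {(xs, ys)}"
proof (intro equalityI subsetI)
  fix z assume "z \<in> saddle_points BP"
  moreover obtain x y where "z = (x, y)" by fastforce
  ultimately have z: "(x, y) \<in> saddle_points BP" and z_eq: "z = (x, y)" by auto
  then have x[simp]: "x \<in> carrier_vec n" and y[simp]: "y \<in> carrier_vec n"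
    unfolding saddle_points_def by (auto simp: bilinear_feasible)
  let ?r = "A *\<^sub>v (x - xs)" and ?g = "transpose_mat A *\<^sub>v (y - ys)"
  \<comment> \<open>Moving the dual variable by the residual \<open>?r\<close> raises the Lagrangian
    by the squared norm of \<open>?r\<close>. Optimality in \<open>y\<close> therefore forces
    \<open>?r\<close> to vanish, and injectivity of \<open>A\<close> gives
    \<open>x = xs\<close>.\<close>
  have "lagrangian BP x (y + ?r) \<le> lagrangian BP x y"
    by (rule saddle_pointsD(1)[OF z, of x]) (simp add: bilinear_feasible)
  moreover have "(y + ?r - ys) \<bullet> ?r = (y - ys) \<bullet> ?r + ?r \<bullet> ?r"
    by (simp add: minus_scalar_prod_distrib[of _ n] add_scalar_prod_distrib[of _ n])
  ultimately have "(vnorm ?r)\<^sup>2 \<le> 0"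
    by (simp add: bilinear_lagrangian vnorm_sq)
  then have "vnorm ?r = 0" by simp
  then have "x - xs = 0\<^sub>v n" by (simp add: mult_eq_0_iff)
  then have "x = xs" by (simp add: vec_diff_eq_0_iff)
  \<comment> \<open>The mirror argument: the primal descent step \<open>- ?g\<close> lowers the
    Lagrangian by the squared norm of \<open>?g\<close>.\<close>
  have "lagrangian BP x y \<le> lagrangian BP (x - ?g) y"
    by (rule saddle_pointsD(2)[OF z, of _ y]) (simp add: bilinear_feasible)
  moreover have "(y - ys) \<bullet> (A *\<^sub>v (x - ?g - xs)) = (y - ys) \<bullet> (A *\<^sub>v (x - xs)) - ?g \<bullet> ?g"
    using transpose_scalar_prod[of A n n "x - ?g - xs" "y - ys"] transpose_scalar_prod[of A n n "x - xs" "y - ys"]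
    by (simp flip: transpose_scalar_prod add: scalar_prod_minus_distrib[of _ n])
  ultimately have "(vnorm ?g)\<^sup>2 \<le> 0"
    by (simp add: bilinear_lagrangian vnorm_sq)
  then have "vnorm ?g = 0" by simp
  then have "y - ys = 0\<^sub>v n" by (simp add: mult_eq_0_iff)
  then have "y = ys" by (simp add: vec_diff_eq_0_iff)
  with \<open>x = xs\<close> show "z \<in> {(xs, ys)}" by (simp add: z_eq)
next
  have zero: "A *\<^sub>v 0\<^sub>v n = 0\<^sub>v n" "xs - xs = 0\<^sub>v n" "ys - ys = 0\<^sub>v n" by auto
  show "z \<in> saddle_points BP" if "z \<in> {(xs, ys)}" for z
    using that unfolding saddle_points_def
    by (simp add: bilinear_feasible bilinear_lagrangian zero del: carrier_dim_vec)
qed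

lemma bilinear_opt_dist: "opt_dist BP z = pdist z (xs, ys)"
  unfolding opt_dist_def bilinear_saddle_points by simp

text \<open>The gap separates into two independent maximizations of a linear term minus
  \<open>\<xi> / 2\<close> times a squared norm, one over the dual and one over the primal block.
  Each contributes the squared norm of its linear term over \<open>2 * \<xi>\<close>.\<close>

lemma bilinear_smoothed_gap:
  assumes [simp]: "x \<in> carrier_vec n" "y \<in> carrier_vec n" and xi: "0 < \<xi>"
  shows "smoothed_gap BP \<xi> (x, y) (xs, ys) =
    ereal (((vnorm (A *\<^sub>v (x - xs)))\<^sup>2 + (vnorm (transpose_mat A *\<^sub>v (y - ys)))\<^sup>2) / (2 * \<xi>))"
proof -
  let ?r = "A *\<^sub>v (x - xs)" and ?g = "- (transpose_mat A *\<^sub>v (y - ys))"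
  have diff: "lagrangian BP x y' - lagrangian BP x' y = (y' - ys) \<bullet> ?r + (x' - xs) \<bullet> ?g"
    if [simp]: "x' \<in> carrier_vec n" "y' \<in> carrier_vec n" for x' y'
  proof -
    have "(y - ys) \<bullet> (A *\<^sub>v (x' - xs)) = (x' - xs) \<bullet> (transpose_mat A *\<^sub>v (y - ys))"
      using transpose_scalar_prod[of A n n "x' - xs" "y - ys"]
      by (simp add: comm_scalar_prod[of "x' - xs" n])
    then show ?thesis
      by (simp add: bilinear_lagrangian)
  qed
  show ?thesis
  \<comment> \<open>The maximizer of each block lies off the saddle point by its linear term divided
    by \<open>\<xi>\<close>.\<close>
  proof (rule smoothed_gap_eqI[of "(xs + (1 / \<xi>) \<cdot>\<^sub>v ?g, ys + (1 / \<xi>) \<cdot>\<^sub>v ?r)"], goal_cases)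
    case 1
    show ?case by (simp add: bilinear_feasible)
  next
    case 2
    have [simp]: "?g \<bullet> ?g = (vnorm ?g)\<^sup>2" "?r \<bullet> ?r = (vnorm ?r)\<^sup>2"
      by (simp_all only: vnorm_sq)
    show ?case using xi
      by (simp add: diff pdist_sq vec_add_diff_cancel[of _ n] vnorm_smult power_mult_distrib del: scalar_prod_uminus_left scalar_prod_uminus_right)
        (simp add: field_simps power2_eq_square)
  next
    case (3 x' y')
    then have [simp]: "x' \<in> carrier_vec n" "y' \<in> carrier_vec n" by (auto simp: bilinear_feasible)
    have "(y' - ys) \<bullet> ?r - \<xi> / 2 * (vnorm (y' - ys))\<^sup>2 \<le> (vnorm ?r)\<^sup>2 / (2 * \<xi>)"
      "(x' - xs) \<bullet> ?g - \<xi> / 2 * (vnorm (x' - xs))\<^sup>2 \<le> (vnorm ?g)\<^sup>2 / (2 * \<xi>)"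
      by (rule scalar_prod_young[of _ n]; use xi in simp)+
    then show ?case
      unfolding fst_conv snd_conv diff[OF \<open>x' \<in> _\<close> \<open>y' \<in> _\<close>] pdist_sq add_divide_distrib
      by (simp add: distrib_left)
  qed
qed

lemma bilinear_growth:
  assumes xi: "0 < \<xi>"
  shows "quadratic_growth BP \<xi> (feasible BP) (s\<^sup>2 / (2 * \<xi>))" and "growth_constant BP \<xi> = s\<^sup>2 / (2 * \<xi>)"
proof -
  show growth: "quadratic_growth BP \<xi> (feasible BP) (s\<^sup>2 / (2 * \<xi>))"
    unfolding quadratic_growth_def
  proof (intro conjI ballI)
    fix zs z assume "zs \<in> saddle_points BP" "z \<in> feasible BP"
    moreover obtain x y where z: "z = (x, y)" by fastforce
    ultimately have [simp]: "x \<in> carrier_vec n" "y \<in> carrier_vec n" and zs: "zs = (xs, ys)"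
      by (auto simp: bilinear_feasible bilinear_saddle_points)
    have "(s * vnorm (x - xs))\<^sup>2 \<le> (vnorm (A *\<^sub>v (x - xs)))\<^sup>2"
      "(s * vnorm (y - ys))\<^sup>2 \<le> (vnorm (transpose_mat A *\<^sub>v (y - ys)))\<^sup>2"
      using s_pos by (intro power_mono lower lower_transpose; simp)+
    then have "s\<^sup>2 * ((vnorm (x - xs))\<^sup>2 + (vnorm (y - ys))\<^sup>2) / (2 * \<xi>) \<le>
        ((vnorm (A *\<^sub>v (x - xs)))\<^sup>2 + (vnorm (transpose_mat A *\<^sub>v (y - ys)))\<^sup>2) / (2 * \<xi>)"
      using xi by (intro divide_right_mono) (simp_all add: power_mult_distrib distrib_left)
    then show "ereal (s\<^sup>2 / (2 * \<xi>) * (opt_dist BP z)\<^sup>2) \<le> smoothed_gap BP \<xi> z zs"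
      unfolding z zs using xi by (simp add: bilinear_smoothed_gap bilinear_opt_dist pdist_sq)
  qed (use s_pos xi in simp)
  \<comment> \<open>The growth bound is tight at a primal displacement by \<open>u\<close>, where
    \<open>A\<close> attains \<open>s\<close>, with the dual variable at its optimum.\<close>
  have x: "xs + u - xs = u" using u by (intro vec_add_diff_cancel) auto
  have y: "ys - ys = 0\<^sub>v n" by simp
  have "transpose_mat A *\<^sub>v 0\<^sub>v n = 0\<^sub>v n" by auto
  then show "growth_constant BP \<xi> = s\<^sup>2 / (2 * \<xi>)"
    using u xi
    by (intro growth_constant_eqI[OF growth, of "(xs, ys)" "(xs + u, ys)"])
      (auto simp: bilinear_saddle_points bilinear_feasible bilinear_opt_dist pdist_def bilinear_smoothed_gap x y)
qed

lemma bilinear_min_complexity: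
  "(INF \<xi>\<in>{0<..}. max (spectral_norm (amat BP) / growth_constant BP \<xi>) (spectral_norm (amat BP) / \<xi>))
     = sqrt 2 * L / s"
proof -
  have amat: "amat BP = A" by (simp add: bilinear_qp_def)
  have "(INF \<xi>\<in>{0<..}. max (spectral_norm (amat BP) / growth_constant BP \<xi>) (spectral_norm (amat BP) / \<xi>))
    = (INF \<xi>\<in>{0<..}. max (2 * L * \<xi> / s\<^sup>2) (L / \<xi>))"
    by (intro INF_cong) (auto simp: bilinear_growth amat spectral_norm_A ac_simps)
  also have "\<dots> = sqrt 2 * L / s"
  proof (rule cInf_eq_minimum)
    \<comment> \<open>The minimizer \<open>s / sqrt 2\<close> is where the increasing and the
      decreasing quotient coincide.\<close>
    show "sqrt 2 * L / s \<in> (\<lambda>\<xi>. max (2 * L * \<xi> / s\<^sup>2) (L / \<xi>)) ` {0<..}"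
      using s_pos L_pos
      by (intro image_eqI[of _ _ "s / sqrt 2"]) (auto simp: field_simps power2_eq_square)
    fix t assume "t \<in> (\<lambda>\<xi>. max (2 * L * \<xi> / s\<^sup>2) (L / \<xi>)) ` {0<..}"
    then obtain \<xi> where xi: "0 < \<xi>" and t: "t = max (2 * L * \<xi> / s\<^sup>2) (L / \<xi>)" by auto
    \<comment> \<open>The product of the two quotients does not depend on \<open>\<xi>\<close>, so
      their maximum is at least its square root.\<close>
    have "(sqrt 2 * L / s)\<^sup>2 = (2 * L * \<xi> / s\<^sup>2) * (L / \<xi>)"
      using xi by (simp add: field_simps power2_eq_square)
    also have "\<dots> \<le> t * t"
      using xi s_pos L_pos by (intro mult_mono') (auto simp: t)
    finally have "(sqrt 2 * L / s)\<^sup>2 \<le> t\<^sup>2" by (simp add: power2_eq_square)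
    moreover have "0 \<le> L / \<xi>" using xi L_pos by simp
    then have "0 \<le> t" unfolding t by (rule max.coboundedI2)
    ultimately show "sqrt 2 * L / s \<le> t" by (rule power2_le_imp_le)
  qed
  finally show ?thesis .
qed

end

section \<open>The least-squares family: gap, growth constant and complexity measure\<close>

context
  fixes xs :: "real vec"
  assumes xs [simp]: "xs \<in> carrier_vec n"
begin

abbreviation "LS \<equiv> least_squares_qp n A xs"

lemma gram_scalar_prod:
  assumes "v \<in> carrier_vec n" "w \<in> carrier_vec n"
  shows "v \<bullet> (transpose_mat A *\<^sub>v (A *\<^sub>v w)) = (A *\<^sub>v v) \<bullet> (A *\<^sub>v w)"
  using transpose_scalar_prod[of A n n v "A *\<^sub>v w"] assms
  by (simp add: comm_scalar_prod[of v n] comm_scalar_prod[of "A *\<^sub>v w" n "A *\<^sub>v v"])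

lemma least_squares_instance: "qp_instance n 1 LS"
proof -
  have "transpose_mat (transpose_mat A * A) = transpose_mat A * A"
    by (simp add: transpose_mult[of _ n n _ n])
  moreover have "0 \<le> v \<bullet> ((transpose_mat A * A) *\<^sub>v v)" if "v \<in> carrier_vec n" for v
    using that by (simp only: gram_mult gram_scalar_prod vnorm_sq[symmetric] zero_le_power2)
  ultimately show ?thesis
    unfolding qp_instance_def least_squares_qp_def psd_def by auto
qed

lemma least_squares_feasible: "feasible LS = carrier_vec n \<times> carrier_vec 1"
  unfolding feasible_def least_squares_qp_def by simp

lemma least_squares_lagrangian:
  assumes [simp]: "x \<in> carrier_vec n" "y \<in> carrier_vec 1"
  shows "lagrangian LS x y = (vnorm (A *\<^sub>v (x - xs)))\<^sup>2 / 2 - (vnorm (A *\<^sub>v xs))\<^sup>2 / 2"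
proof -
  have "(A *\<^sub>v (x - xs)) \<bullet> (A *\<^sub>v (x - xs)) =
      (A *\<^sub>v x) \<bullet> (A *\<^sub>v x) - 2 * ((A *\<^sub>v x) \<bullet> (A *\<^sub>v xs)) + (A *\<^sub>v xs) \<bullet> (A *\<^sub>v xs)"
    by (simp add: mult_minus_distrib_mat_vec[of _ n n] minus_scalar_prod_distrib[of _ n]
        scalar_prod_minus_distrib[of _ n] comm_scalar_prod[of "A *\<^sub>v xs" n "A *\<^sub>v x"])
  moreover have "(- (transpose_mat A *\<^sub>v (A *\<^sub>v xs))) \<bullet> x = - ((A *\<^sub>v x) \<bullet> (A *\<^sub>v xs))"
    using gram_scalar_prod[of x xs]
    by (simp add: carrier_vecD[OF assms(1)] comm_scalar_prod[of "transpose_mat A *\<^sub>v (A *\<^sub>v xs)" n x])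
  moreover have "x \<bullet> ((transpose_mat A * A) *\<^sub>v x) = (A *\<^sub>v x) \<bullet> (A *\<^sub>v x)"
    by (simp only: gram_mult gram_scalar_prod assms)
  moreover have "y \<bullet> (0\<^sub>m 1 n *\<^sub>v x) = 0" "0\<^sub>v 1 \<bullet> y = 0"
    using assms(2) by (simp_all add: zero_mult_mat_vec scalar_prod_right_zero[of _ 1] scalar_prod_left_zero[of _ 1])
  ultimately show ?thesis
    unfolding lagrangian_def least_squares_qp_def vnorm_sq by (simp add: field_simps)
qed

lemma least_squares_grad_x:
  assumes x: "x \<in> carrier_vec n" and y: "y \<in> carrier_vec 1"
  shows "grad_x LS x y = transpose_mat A *\<^sub>v (A *\<^sub>v (x - xs))"
proof -
  have "transpose_mat (0\<^sub>m 1 n) *\<^sub>v y = (0\<^sub>v n :: real vec)"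
    using zero_mult_mat_vec[OF y, of n] by simp
  moreover have "a + - b + 0\<^sub>v n = a - b" if "a \<in> carrier_vec n" "b \<in> carrier_vec n" for a b :: "real vec"
    using that by (intro eq_vecI) auto
  ultimately show ?thesis
    unfolding grad_lagrangian(1)[OF least_squares_instance x y]
    using x by (simp add: least_squares_qp_def mult_minus_distrib_mat_vec[of _ n n] gram_mult)
qed

text \<open>The Lagrangian ignores \<open>y\<close>, so every dual vector is optimal. The primal
  solution is unique because \<open>A\<close> is injective.\<close>

lemma least_squares_saddle_points: "saddle_points LS = {xs} \<times> carrier_vec 1"
proof (intro equalityI subsetI)
  have A0: "vnorm (A *\<^sub>v (xs - xs)) = 0"
    by (subst mult_eq_0_iff) auto
  fix z assume "z \<in> saddle_points LS"
  moreover obtain x y where "z = (x, y)" by fastforce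
  ultimately have z: "(x, y) \<in> saddle_points LS" and z_eq: "z = (x, y)" by auto
  then have x[simp]: "x \<in> carrier_vec n" and y: "y \<in> carrier_vec 1"
    unfolding saddle_points_def by (auto simp: least_squares_feasible)
  have "lagrangian LS x y \<le> lagrangian LS xs y"
    using y by (intro saddle_pointsD(2)[OF z]) (auto simp: least_squares_feasible)
  then have "(vnorm (A *\<^sub>v (x - xs)))\<^sup>2 \<le> 0"
    unfolding least_squares_lagrangian[OF x y] least_squares_lagrangian[OF xs y] A0 by simp
  then have "x - xs = 0\<^sub>v n" by (simp add: mult_eq_0_iff)
  then show "z \<in> {xs} \<times> carrier_vec 1"
    using y by (simp add: z_eq vec_diff_eq_0_iff)
next
  have A0: "vnorm (A *\<^sub>v (xs - xs)) = 0"
    by (subst mult_eq_0_iff) auto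
  fix z :: "real vec \<times> real vec" assume "z \<in> {xs} \<times> carrier_vec 1"
  then show "z \<in> saddle_points LS"
    unfolding saddle_points_def least_squares_feasible
    by (auto simp: least_squares_lagrangian A0 simp del: carrier_dim_vec)
qed

text \<open>Every dual vector being optimal, the nearest saddle point shares the dual part and only
  the primal error counts.\<close>

lemma least_squares_opt_dist:
  assumes y: "y \<in> carrier_vec 1"
  shows "opt_dist LS (x, y) = vnorm (x - xs)"
  unfolding opt_dist_def
proof (rule cInf_eq_minimum)
  show "vnorm (x - xs) \<in> pdist (x, y) ` saddle_points LS"
    using y by (intro image_eqI[of _ _ "(xs, y)"]) (auto simp: least_squares_saddle_points pdist_def)
  fix t assume "t \<in> pdist (x, y) ` saddle_points LS"
  then obtain y' where "t = pdist (x, y) (xs, y')"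
    unfolding least_squares_saddle_points by auto
  then show "vnorm (x - xs) \<le> t"
    unfolding pdist_def by (auto intro: real_le_rsqrt)
qed

text \<open>The minimizer \<open>xs\<close> of the objective is also the center of the primal
  penalty, so the penalty costs nothing and the gap is the objective gap, whatever
  \<open>\<xi>\<close> is.\<close>

lemma least_squares_smoothed_gap:
  assumes x [simp]: "x \<in> carrier_vec n" and y: "y \<in> carrier_vec 1" and y': "y' \<in> carrier_vec 1"
    and xi: "0 < \<xi>"
  shows "smoothed_gap LS \<xi> (x, y) (xs, y') = ereal ((vnorm (A *\<^sub>v (x - xs)))\<^sup>2 / 2)"
proof (rule smoothed_gap_eqI[of "(xs, y')"], goal_cases)
  case 1
  show ?case using y' by (simp add: least_squares_feasible)
next
  case 2
  have "vnorm (A *\<^sub>v (xs - xs)) = 0"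
    by (subst mult_eq_0_iff) auto
  moreover have "pdist (xs, y') (xs, y') = 0"
    unfolding pdist_def using y' by simp
  ultimately show ?case
    unfolding fst_conv snd_conv least_squares_lagrangian[OF x y'] least_squares_lagrangian[OF xs y]
    by simp
next
  case (3 x1 y1)
  then have x1: "x1 \<in> carrier_vec n" and y1: "y1 \<in> carrier_vec 1"
    unfolding least_squares_feasible by auto
  have "0 \<le> \<xi> / 2 * (pdist (x1, y1) (xs, y'))\<^sup>2" using xi by simp
  moreover have "0 \<le> (vnorm (A *\<^sub>v (x1 - xs)))\<^sup>2" by simp
  ultimately show ?case
    unfolding fst_conv snd_conv least_squares_lagrangian[OF x y1] least_squares_lagrangian[OF x1 y]
    by linarith
qed

lemma least_squares_growth:
  assumes xi: "0 < \<xi>"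
  shows "quadratic_growth LS \<xi> (feasible LS) (s\<^sup>2 / 2)" and "growth_constant LS \<xi> = s\<^sup>2 / 2"
proof -
  show growth: "quadratic_growth LS \<xi> (feasible LS) (s\<^sup>2 / 2)"
    unfolding quadratic_growth_def
  proof (intro conjI ballI)
    fix zs z assume "zs \<in> saddle_points LS" "z \<in> feasible LS"
    then obtain x y y' where x: "x \<in> carrier_vec n" and y: "y \<in> carrier_vec 1" and y': "y' \<in> carrier_vec 1"
      and z: "z = (x, y)" and zs: "zs = (xs, y')"
      unfolding least_squares_feasible least_squares_saddle_points by auto
    have "(s * vnorm (x - xs))\<^sup>2 \<le> (vnorm (A *\<^sub>v (x - xs)))\<^sup>2"
      using s_pos x by (intro power_mono lower; simp)
    then show "ereal (s\<^sup>2 / 2 * (opt_dist LS z)\<^sup>2) \<le> smoothed_gap LS \<xi> z zs"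
      unfolding z zs least_squares_smoothed_gap[OF x y y' xi] least_squares_opt_dist[OF y]
      by (simp add: power_mult_distrib)
  qed (use s_pos in simp)
  have x: "xs + u - xs = u" using u by (intro vec_add_diff_cancel) auto
  have zero: "0\<^sub>v 1 \<in> carrier_vec 1" by simp
  have xu: "xs + u \<in> carrier_vec n" using u by simp
  show "growth_constant LS \<xi> = s\<^sup>2 / 2"
  proof (rule growth_constant_eqI[OF growth, of "(xs, 0\<^sub>v 1)" "(xs + u, 0\<^sub>v 1)"])
    show "smoothed_gap LS \<xi> (xs + u, 0\<^sub>v 1) (xs, 0\<^sub>v 1) = ereal (s\<^sup>2 / 2)"
      unfolding least_squares_smoothed_gap[OF xu zero zero xi] x u(3) ..
    show "opt_dist LS (xs + u, 0\<^sub>v 1) = 1"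
      unfolding least_squares_opt_dist[OF zero] x u(2) ..
  qed (use xu in \<open>auto simp: least_squares_feasible least_squares_saddle_points\<close>)
qed

lemma least_squares_min_complexity:
  "(INF \<xi>\<in>{0<..}. max (sqrt (spectral_norm (qmat LS) / growth_constant LS \<xi>)) (sqrt (spectral_norm (qmat LS) / \<xi>)))
     = sqrt 2 * L / s"
proof -
  have qmat: "qmat LS = transpose_mat A * A" by (simp add: least_squares_qp_def)
  have sqrt_eq: "sqrt (L\<^sup>2 / (s\<^sup>2 / 2)) = sqrt 2 * L / s"
    using s_pos L_pos by (simp add: real_sqrt_divide real_sqrt_mult)
  show ?thesis
    unfolding qmat spectral_norm_gram
  proof (rule cInf_eq_minimum)
    \<comment> \<open>The growth constant does not depend on \<open>\<xi>\<close>, so the first root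
      is a lower bound. It is attained once the second root is no larger, for instance at
      \<open>\<xi> = s^2 / 2\<close>, where both agree.\<close>
    show "sqrt 2 * L / s \<in> (\<lambda>\<xi>. max (sqrt (L\<^sup>2 / growth_constant LS \<xi>)) (sqrt (L\<^sup>2 / \<xi>))) ` {0<..}"
      using s_pos sqrt_eq by (intro image_eqI[of _ _ "s\<^sup>2 / 2"]) (auto simp: least_squares_growth)
    fix t assume "t \<in> (\<lambda>\<xi>. max (sqrt (L\<^sup>2 / growth_constant LS \<xi>)) (sqrt (L\<^sup>2 / \<xi>))) ` {0<..}"
    then obtain \<xi> where "0 < \<xi>" "t = max (sqrt (L\<^sup>2 / growth_constant LS \<xi>)) (sqrt (L\<^sup>2 / \<xi>))"
      by auto
    then show "sqrt 2 * L / s \<le> t"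
      using sqrt_eq by (simp add: least_squares_growth)
  qed
qed

end

end

subsection \<open>The worst-case matrix\<close>

text \<open>
  The two extra coordinates \<open>N\<close> and \<open>N + 1\<close> are decoupled from the others and from every run;
  they only make the bounds \<open>1 - q\<close> and \<open>1 + q\<close> on the singular values attained.
\<close>

definition hard_matrix :: "nat \<Rightarrow> real \<Rightarrow> real mat" where
  "hard_matrix N q = mat (N + 2) (N + 2) (\<lambda>(i, j).
     (if i = j then (if i < N then 1 else if i = N then 1 - q else 1 + q) else 0)
     - (if i = Suc j \<and> i < N then q else 0))"

text \<open>
  The matrix is \<open>I - q S\<close> for the partial isometry \<open>S\<close> acting as \<open>shift_down\<close>, whose transpose
  acts as \<open>shift_up\<close>.
\<close>

definition shift_down :: "nat \<Rightarrow> (nat \<Rightarrow> real) \<Rightarrow> nat \<Rightarrow> real" where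
  "shift_down N v i = (if i = 0 \<and> 0 < N then 0 else if i < N then v (i - 1) else if i = N then v i else - v i)"

definition shift_up :: "nat \<Rightarrow> (nat \<Rightarrow> real) \<Rightarrow> nat \<Rightarrow> real" where
  "shift_up N v i = (if Suc i < N then v (Suc i) else if i < N then 0 else if i = N then v i else - v i)"

lemma hard_matrix_carrier: "hard_matrix N q \<in> carrier_mat (N + 2) (N + 2)"
  unfolding hard_matrix_def by simp

lemma hard_matrix_mult_index:
  assumes v: "v \<in> carrier_vec (N + 2)" and i: "i < N + 2"
  shows "(hard_matrix N q *\<^sub>v v) $ i = v $ i - q * shift_down N (($) v) i"
proof -
  let ?d = "if i < N then 1 else if i = N then 1 - q else 1 + q"
  have "(hard_matrix N q *\<^sub>v v) $ i = (\<Sum>j<N+2. hard_matrix N q $$ (i, j) * v $ j)"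
    using v i hard_matrix_carrier[of N q]
    by (auto simp: scalar_prod_def atLeast0LessThan intro!: sum.cong)
  also have "\<dots> = (\<Sum>j<N+2. (if j = i then ?d * v $ i else 0) - (if i = Suc j \<and> i < N then q * v $ (i - 1) else 0))"
    using i by (intro sum.cong) (auto simp: hard_matrix_def)
  \<comment> \<open>The guard \<open>0 < i\<close> is needed because \<open>i - 1\<close> is
    truncated: row 0 has no subdiagonal entry.\<close>
  also have "\<dots> = ?d * v $ i - (\<Sum>j<N+2. if j = i - 1 then (if 0 < i \<and> i < N then q * v $ (i - 1) else 0) else 0)"
    using i unfolding sum_subtractf by (intro arg_cong2[where f = "(-)"] sum.cong) (auto simp: sum.delta)
  also have "\<dots> = v $ i - q * shift_down N (($) v) i"
    using i by (auto simp: sum.delta shift_down_def algebra_simps)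
  finally show ?thesis .
qed

lemma hard_matrix_transpose_mult_index:
  assumes v: "v \<in> carrier_vec (N + 2)" and i: "i < N + 2"
  shows "(transpose_mat (hard_matrix N q) *\<^sub>v v) $ i = v $ i - q * shift_up N (($) v) i"
proof -
  let ?d = "if i < N then 1 else if i = N then 1 - q else 1 + q"
  have "(transpose_mat (hard_matrix N q) *\<^sub>v v) $ i = (\<Sum>j<N+2. hard_matrix N q $$ (j, i) * v $ j)"
    using v i hard_matrix_carrier[of N q]
    by (auto simp: scalar_prod_def atLeast0LessThan intro!: sum.cong)
  also have "\<dots> = (\<Sum>j<N+2. (if j = i then ?d * v $ i else 0) - (if j = Suc i then (if Suc i < N then q * v $ Suc i else 0) else 0))"
    using i by (intro sum.cong) (auto simp: hard_matrix_def)
  also have "\<dots> = v $ i - q * shift_up N (($) v) i"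
    using i unfolding sum_subtractf by (auto simp: sum.delta shift_up_def algebra_simps)
  finally show ?thesis .
qed

text \<open>Among the first \<open>N\<close> coordinates the shift discards only the last entry, and
  on the two extra ones it changes at most a sign. The transposed shift discards the first entry
  instead.\<close>

lemma sum_shift_down_le: "(\<Sum>i<N + 2. (shift_down N v i)\<^sup>2) \<le> (\<Sum>i<N + 2. (v i)\<^sup>2)"
proof -
  have "(\<Sum>i<N. (shift_down N v i)\<^sup>2) \<le> (\<Sum>i<N. (v i)\<^sup>2)"
  proof (cases N)
    case (Suc M)
    have "(\<Sum>i<N. (shift_down N v i)\<^sup>2) = (\<Sum>i<M. (v i)\<^sup>2)"
      unfolding Suc sum.lessThan_Suc_shift by (simp add: shift_down_def)
    also have "\<dots> \<le> (\<Sum>i<N. (v i)\<^sup>2)"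
      unfolding Suc by simp
    finally show ?thesis .
  qed simp
  then show ?thesis by (simp add: shift_down_def)
qed

lemma sum_shift_up_le: "(\<Sum>i<N + 2. (shift_up N v i)\<^sup>2) \<le> (\<Sum>i<N + 2. (v i)\<^sup>2)"
proof -
  have "(\<Sum>i<N. (shift_up N v i)\<^sup>2) \<le> (\<Sum>i<N. (v i)\<^sup>2)"
  proof (cases N)
    case (Suc M)
    have "(\<Sum>i<N. (shift_up N v i)\<^sup>2) = (\<Sum>i<M. (v (Suc i))\<^sup>2)"
      unfolding Suc by (simp add: shift_up_def)
    also have "\<dots> \<le> (\<Sum>i<N. (v i)\<^sup>2)"
      unfolding Suc sum.lessThan_Suc_shift by simp
    finally show ?thesis .
  qed simp
  then show ?thesis by (simp add: shift_up_def)
qed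

text \<open>The triangle inequality in squared form. Termwise, \<open>(v i - q * w i)^2\<close>
  exceeds \<open>(1 - q) * ((v i)^2 - q * (w i)^2)\<close> by exactly
  \<open>q * (v i - w i)^2\<close>, and it falls short of the corresponding upper bound by
  \<open>q * (v i + w i)^2\<close>.\<close>

lemma perturbed_norm_bounds:
  fixes v w :: "nat \<Rightarrow> real"
  assumes q: "0 \<le> q" "q \<le> 1" and w: "(\<Sum>i<n. (w i)\<^sup>2) \<le> (\<Sum>i<n. (v i)\<^sup>2)"
  shows "(1 - q)\<^sup>2 * (\<Sum>i<n. (v i)\<^sup>2) \<le> (\<Sum>i<n. (v i - q * w i)\<^sup>2)"
    and "(\<Sum>i<n. (v i - q * w i)\<^sup>2) \<le> (1 + q)\<^sup>2 * (\<Sum>i<n. (v i)\<^sup>2)"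
proof -
  let ?V = "\<Sum>i<n. (v i)\<^sup>2" and ?W = "\<Sum>i<n. (w i)\<^sup>2"
  have "(1 - q)\<^sup>2 * ?V = (1 - q) * (?V - q * ?V)" by (simp add: power2_eq_square algebra_simps)
  also have "\<dots> \<le> (1 - q) * (?V - q * ?W)"
    using q w by (intro mult_left_mono) (auto intro: mult_left_mono)
  also have "\<dots> = (\<Sum>i<n. (1 - q) * ((v i)\<^sup>2 - q * (w i)\<^sup>2))"
    by (simp only: sum_distrib_left[symmetric] sum_subtractf)
  also have "\<dots> \<le> (\<Sum>i<n. (v i - q * w i)\<^sup>2)"
  proof (rule sum_mono)
    fix i
    have "0 \<le> q * (v i - w i)\<^sup>2" using q by simp
    then show "(1 - q) * ((v i)\<^sup>2 - q * (w i)\<^sup>2) \<le> (v i - q * w i)\<^sup>2"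
      by (simp add: power2_eq_square algebra_simps)
  qed
  finally show "(1 - q)\<^sup>2 * ?V \<le> (\<Sum>i<n. (v i - q * w i)\<^sup>2)" .
  have "(\<Sum>i<n. (v i - q * w i)\<^sup>2) \<le> (\<Sum>i<n. (1 + q) * ((v i)\<^sup>2 + q * (w i)\<^sup>2))"
  proof (rule sum_mono)
    fix i
    have "0 \<le> q * (v i + w i)\<^sup>2" using q by simp
    then show "(v i - q * w i)\<^sup>2 \<le> (1 + q) * ((v i)\<^sup>2 + q * (w i)\<^sup>2)"
      by (simp add: power2_eq_square algebra_simps)
  qed
  also have "\<dots> = (1 + q) * (?V + q * ?W)"
    by (simp only: sum_distrib_left[symmetric] sum.distrib)
  also have "\<dots> \<le> (1 + q) * (?V + q * ?V)"
    using q w by (intro mult_left_mono) (auto intro: mult_left_mono)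
  also have "\<dots> = (1 + q)\<^sup>2 * ?V" by (simp add: power2_eq_square algebra_simps)
  finally show "(\<Sum>i<n. (v i - q * w i)\<^sup>2) \<le> (1 + q)\<^sup>2 * ?V" .
qed

lemma vnorm_perturbed_bounds:
  assumes q: "0 \<le> q" "q \<le> 1" and dims: "dim_vec v = n" "dim_vec Mv = n"
    and index: "\<And>i. i < n \<Longrightarrow> Mv $ i = v $ i - q * w i"
    and w: "(\<Sum>i<n. (w i)\<^sup>2) \<le> (\<Sum>i<n. (v $ i)\<^sup>2)"
  shows "(1 - q) * vnorm v \<le> vnorm Mv" and "vnorm Mv \<le> (1 + q) * vnorm v"
proof -
  have Mv: "(vnorm Mv)\<^sup>2 = (\<Sum>i<n. (v $ i - q * w i)\<^sup>2)"
    unfolding vnorm_sq_sum dims by (simp add: index)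
  have "((1 - q) * vnorm v)\<^sup>2 \<le> (vnorm Mv)\<^sup>2"
    using perturbed_norm_bounds(1)[OF q w] by (simp only: Mv power_mult_distrib vnorm_sq_sum[of v] dims)
  then show "(1 - q) * vnorm v \<le> vnorm Mv" by (rule power2_le_imp_le) simp
  have "(vnorm Mv)\<^sup>2 \<le> ((1 + q) * vnorm v)\<^sup>2"
    using perturbed_norm_bounds(2)[OF q w] by (simp only: Mv power_mult_distrib vnorm_sq_sum[of v] dims)
  then show "vnorm Mv \<le> (1 + q) * vnorm v" by (rule power2_le_imp_le) (use q in simp)
qed

lemma hard_matrix_bounded_below:
  assumes q: "0 \<le> q" "q < 1"
  shows "bounded_below_matrix (N + 2) (hard_matrix N q) (1 - q) (1 + q) (unit_vec (N + 2) N) (unit_vec (N + 2) (N + 1))"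
proof
  let ?n = "N + 2" and ?A = "hard_matrix N q"
  have rows: "dim_row ?A = ?n" "dim_col ?A = ?n" by (simp_all add: hard_matrix_def)
  fix v :: "real vec" assume v: "v \<in> carrier_vec ?n"
  have q1: "q \<le> 1" using q by simp
  show "(1 - q) * vnorm v \<le> vnorm (?A *\<^sub>v v)" "vnorm (?A *\<^sub>v v) \<le> (1 + q) * vnorm v"
    by (rule vnorm_perturbed_bounds[OF q(1) q1 _ _ hard_matrix_mult_index[OF v] sum_shift_down_le];
        use v rows in simp)+
  show "(1 - q) * vnorm v \<le> vnorm (transpose_mat ?A *\<^sub>v v)" "vnorm (transpose_mat ?A *\<^sub>v v) \<le> (1 + q) * vnorm v"
    by (rule vnorm_perturbed_bounds[OF q(1) q1 _ _ hard_matrix_transpose_mult_index[OF v] sum_shift_up_le];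
        use v rows in simp)+
next
  let ?n = "N + 2" and ?A = "hard_matrix N q"
  have rows: "dim_row ?A = ?n" "dim_col ?A = ?n" by (simp_all add: hard_matrix_def)
  have u: "?A *\<^sub>v unit_vec ?n N = (1 - q) \<cdot>\<^sub>v unit_vec ?n N"
    by (rule eq_vecI, subst hard_matrix_mult_index) (auto simp: rows shift_down_def)
  show "vnorm (?A *\<^sub>v unit_vec ?n N) = 1 - q"
    unfolding u vnorm_smult using q by simp
  show "?A *\<^sub>v unit_vec ?n (N + 1) = (1 + q) \<cdot>\<^sub>v unit_vec ?n (N + 1)"
    by (rule eq_vecI, subst hard_matrix_mult_index) (auto simp: rows shift_down_def)
  show "transpose_mat ?A *\<^sub>v unit_vec ?n (N + 1) = (1 + q) \<cdot>\<^sub>v unit_vec ?n (N + 1)"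
    by (rule eq_vecI, subst hard_matrix_transpose_mult_index) (auto simp: rows shift_up_def)
qed (use q hard_matrix_carrier[of N q] in auto)

subsection \<open>Runs of span-respecting algorithms\<close>

lemma affine_span_coordinate:
  assumes x: "x \<in> {x0 + d | d. d \<in> vspan n S}" and x0: "x0 \<in> carrier_vec n" and S: "S \<subseteq> carrier_vec n"
  shows "x \<in> carrier_vec n" and "j < n \<Longrightarrow> (\<And>v. v \<in> S \<Longrightarrow> v $ j = 0) \<Longrightarrow> x $ j = x0 $ j"
proof -
  obtain d where d: "d \<in> vspan n S" "x = x0 + d" using x by auto
  have dc: "d \<in> carrier_vec n" by (rule span_vec_carrier[OF S d(1)])
  then show "x \<in> carrier_vec n" using x0 d by simp
  show "x $ j = x0 $ j" if "j < n" "\<And>v. v \<in> S \<Longrightarrow> v $ j = 0"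
    using span_coordinate_eq_0[OF S that d(1)] dc x0 d(2) that(1) by simp
qed

section \<open>The geometric solution and its tail\<close>

text \<open>
  The solution of \<open>hard_matrix N q *\<^sub>v w = c \<cdot>\<^sub>v unit_vec (N + 2) 0\<close>, with \<open>c\<close> chosen such that
  \<open>w\<close> has norm 1.
\<close>

definition hard_solution :: "nat \<Rightarrow> real \<Rightarrow> real vec" where
  "hard_solution N q = vec (N + 2) (\<lambda>i. if i < N then sqrt ((1 - q\<^sup>2) / (1 - (q\<^sup>2) ^ N)) * q ^ i else 0)"

lemma hard_solution_carrier: "hard_solution N q \<in> carrier_vec (N + 2)"
  by (simp add: hard_solution_def)

lemma power_sq_lt_1:
  fixes q :: real
  assumes "0 < q" "q < 1" "0 < N"
  shows "(q\<^sup>2) ^ N < 1"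
  using assms by (simp add: power_less_one_iff)

lemma hard_solution_index_sq:
  assumes "0 < q" "q < 1" "0 < N" "i < N"
  shows "(hard_solution N q $ i)\<^sup>2 = (1 - q\<^sup>2) / (1 - (q\<^sup>2) ^ N) * (q\<^sup>2) ^ i"
proof -
  have "0 \<le> (1 - q\<^sup>2) / (1 - (q\<^sup>2) ^ N)"
    using power_sq_lt_1[OF assms(1-3)] power_sq_lt_1[OF assms(1,2), of 1] by simp
  then show ?thesis
    using assms by (simp add: hard_solution_def power_mult_distrib flip: power_mult) (simp add: mult.commute)
qed

lemma hard_solution_tail:
  assumes q: "0 < q" "q < 1" and k: "k < N"
  shows "(\<Sum>i=k..<N. (hard_solution N q $ i)\<^sup>2) = ((q\<^sup>2) ^ k - (q\<^sup>2) ^ N) / (1 - (q\<^sup>2) ^ N)"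
proof -
  have N: "0 < N" using k by simp
  have a: "q\<^sup>2 < 1" using power_sq_lt_1[OF q, of 1] by simp
  have "(\<Sum>i=k..<N. (hard_solution N q $ i)\<^sup>2) = (1 - q\<^sup>2) / (1 - (q\<^sup>2) ^ N) * (\<Sum>i=k..<N. (q\<^sup>2) ^ i)"
    unfolding sum_distrib_left using q N by (intro sum.cong) (auto simp: hard_solution_index_sq)
  also have "(\<Sum>i=k..<N. (q\<^sup>2) ^ i) = ((q\<^sup>2) ^ k - (q\<^sup>2) ^ N) / (1 - q\<^sup>2)"
  proof -
    \<comment> \<open>Multiplication by \<open>1 - q^2\<close> makes the geometric sum
      telescope.\<close>
    have "(1 - q\<^sup>2) * (\<Sum>i=k..<N. (q\<^sup>2) ^ i) = - (\<Sum>i=k..<N. (q\<^sup>2) ^ Suc i - (q\<^sup>2) ^ i)"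
      unfolding sum_distrib_left sum_negf[symmetric] by (intro sum.cong) (auto simp: algebra_simps)
    also have "\<dots> = (q\<^sup>2) ^ k - (q\<^sup>2) ^ N"
      using k sum_Suc_diff'[of k N "\<lambda>i. (q\<^sup>2) ^ i"] by simp
    finally show ?thesis using a by (simp add: field_simps)
  qed
  finally show ?thesis using a by simp
qed

lemma hard_solution_norm:
  assumes q: "0 < q" "q < 1" and N: "0 < N"
  shows "vnorm (hard_solution N q) = 1"
proof -
  have "(vnorm (hard_solution N q))\<^sup>2 = (\<Sum>i=0..<N. (hard_solution N q $ i)\<^sup>2)"
    unfolding vnorm_sq_sum by (simp add: hard_solution_def atLeast0LessThan)
  also have "\<dots> = 1"
    using hard_solution_tail[OF q N] power_sq_lt_1[OF q N] by simp
  finally show ?thesis using vnorm_nonneg[of "hard_solution N q"] by (simp add: power2_eq_1_iff)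
qed

text \<open>From index \<open>k\<close> on the error is minus the solution, so the tail of the
  solution has squared norm at most \<open>\<epsilon>^2\<close>. The choice of \<open>N\<close>
  absorbs the truncation term. Concluding with \<open>\<epsilon>\<close> instead of
  \<open>\<epsilon>^2\<close> costs only a factor 2 in the logarithm.\<close>

lemma hard_solution_dist:
  assumes q: "0 < q" "q < 1" and N: "(q\<^sup>2) ^ N \<le> \<epsilon> / 2" and eps: "0 < \<epsilon>" "\<epsilon> < 1"
    and x0: "x0 \<in> carrier_vec (N + 2)" and x: "x \<in> carrier_vec (N + 2)"
    and agree: "\<And>j. k \<le> j \<Longrightarrow> j < N + 2 \<Longrightarrow> x $ j = x0 $ j"
    and dist: "vnorm (x - (x0 + hard_solution N q)) \<le> \<epsilon>"
  shows "(q\<^sup>2) ^ k \<le> \<epsilon>"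
proof (cases "k < N")
  \<comment> \<open>Once \<open>k\<close> reaches \<open>N\<close> nothing of the solution need be
    missing, but the choice of \<open>N\<close> alone gives the bound.\<close>
  case False
  then have "(q\<^sup>2) ^ k \<le> (q\<^sup>2) ^ N"
    using q by (intro power_decreasing) (auto simp: power_le_one)
  then show ?thesis using N eps by simp
next
  case True
  let ?w = "hard_solution N q" and ?r = "(q\<^sup>2) ^ N"
  have r: "?r < 1" using True by (intro power_sq_lt_1[OF q]) simp
  have r0: "0 \<le> ?r" by simp
  have "(?w $ i)\<^sup>2 = ((x - (x0 + ?w)) $ i)\<^sup>2" if "i \<in> {k..<N}" for i
    using that agree[of i] x x0 hard_solution_carrier[of N q] by simp
  then have "(\<Sum>i=k..<N. (?w $ i)\<^sup>2) = (\<Sum>i=k..<N. ((x - (x0 + ?w)) $ i)\<^sup>2)"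
    by (rule sum.cong[OF refl])
  also have "\<dots> \<le> (\<Sum>i<N + 2. ((x - (x0 + ?w)) $ i)\<^sup>2)"
    by (intro sum_mono2) auto
  also have "\<dots> = (vnorm (x - (x0 + ?w)))\<^sup>2"
    unfolding vnorm_sq_sum using carrier_vecD[OF hard_solution_carrier[of N q]] by simp
  also have "\<dots> \<le> \<epsilon>\<^sup>2" using dist by (intro power_mono) auto
  finally have "((q\<^sup>2) ^ k - ?r) / (1 - ?r) \<le> \<epsilon>\<^sup>2"
    unfolding hard_solution_tail[OF q True] .
  then have "(q\<^sup>2) ^ k - ?r \<le> \<epsilon>\<^sup>2 * (1 - ?r)"
    using r by (simp add: pos_divide_le_eq)
  then have "(q\<^sup>2) ^ k \<le> \<epsilon>\<^sup>2 + (1 - \<epsilon>\<^sup>2) * ?r" by (simp add: algebra_simps)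
  also have "\<dots> \<le> \<epsilon>\<^sup>2 + (1 - \<epsilon>\<^sup>2) * (\<epsilon> / 2)"
    using N eps by (intro add_left_mono mult_left_mono) (auto simp: power_le_one)
  also have "\<dots> \<le> \<epsilon>"
  proof -
    \<comment> \<open>This product is exactly the slack in the claimed inequality.\<close>
    have "0 \<le> \<epsilon> * (1 - \<epsilon>) * (1 - \<epsilon>) / 2" using eps by simp
    also have "\<dots> = \<epsilon> - (\<epsilon>\<^sup>2 + (1 - \<epsilon>\<^sup>2) * (\<epsilon> / 2))"
      by (simp add: power2_eq_square field_simps)
    finally show ?thesis by simp
  qed
  finally show ?thesis .
qed

text \<open>Row \<open>r\<close> sees at most the entries \<open>r - 1\<close> and \<open>r\<close>,
  both at or beyond \<open>k\<close>, where the error is minus the solution. Below \<open>N\<close>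
  the geometric recurrence cancels them, and from \<open>N\<close> on the solution is 0. Hence one
  residual activates at most the single new index \<open>k\<close>.\<close>

lemma hard_matrix_residual_index:
  assumes x0: "x0 \<in> carrier_vec (N + 2)" and x: "x \<in> carrier_vec (N + 2)"
    and agree: "\<And>j. k \<le> j \<Longrightarrow> j < N + 2 \<Longrightarrow> x $ j = x0 $ j"
    and r: "k < r" "r < N + 2"
  shows "(hard_matrix N q *\<^sub>v (x - (x0 + hard_solution N q))) $ r = 0"
proof -
  let ?e = "x - (x0 + hard_solution N q)"
  have e: "?e \<in> carrier_vec (N + 2)"
    using x x0 hard_solution_carrier[of N q] by simp
  have index: "?e $ j = - hard_solution N q $ j" if "k \<le> j" "j < N + 2" for j
    using agree[OF that] that x x0 hard_solution_carrier[of N q] by simp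
  have e_r: "?e $ r = - hard_solution N q $ r" "?e $ (r - 1) = - hard_solution N q $ (r - 1)"
    using r by (auto intro!: index)
  show ?thesis
    unfolding hard_matrix_mult_index[OF e r(2)] shift_down_def e_r
    using r by (cases r) (auto simp: hard_solution_def)
qed

text \<open>The transpose is upper bidiagonal, so row \<open>r\<close> only sees entries from
  \<open>r\<close> on: the transpose never activates a new coordinate.\<close>

lemma hard_matrix_transpose_index_eq_0:
  assumes v: "v \<in> carrier_vec (N + 2)" and zero: "\<And>j. r \<le> j \<Longrightarrow> j < N + 2 \<Longrightarrow> v $ j = 0" and r: "r < N + 2"
  shows "(transpose_mat (hard_matrix N q) *\<^sub>v v) $ r = 0"
  unfolding hard_matrix_transpose_mult_index[OF v r] using zero r by (auto simp: shift_up_def)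

text \<open>The bounds \<open>k \<le> j\<close> and \<open>k < j\<close> differ because
  \<open>Y k\<close> may use gradients at \<open>X k\<close>. The dual gradient activates one new
  index; the primal gradient, through the transpose, only passes on the indices that earlier dual
  iterates have reached.\<close>

lemma bilinear_iterates_agree:
  assumes q: "0 < q" "q < 1" and x0: "x0 \<in> carrier_vec (N + 2)" and y0: "y0 \<in> carrier_vec (N + 2)"
    and run: "span_respecting (bilinear_qp (N + 2) (hard_matrix N q) (x0 + hard_solution N q) y0) X Y"
    and init: "X 0 = x0" "Y 0 = y0"
  shows "X k \<in> carrier_vec (N + 2) \<and> Y k \<in> carrier_vec (N + 2) \<and>
    (\<forall>j<N + 2. k \<le> j \<longrightarrow> X k $ j = x0 $ j) \<and> (\<forall>j<N + 2. k < j \<longrightarrow> Y k $ j = y0 $ j)"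
proof (induction k rule: less_induct)
  case (less k)
  let ?n = "N + 2" and ?A = "hard_matrix N q" and ?xs = "x0 + hard_solution N q"
  let ?P = "bilinear_qp ?n ?A ?xs y0"
  interpret M: bounded_below_matrix ?n ?A "1 - q" "1 + q" "unit_vec ?n N" "unit_vec ?n (N + 1)"
    using q by (intro hard_matrix_bounded_below) auto
  have xs: "?xs \<in> carrier_vec ?n" using x0 hard_solution_carrier[of N q] by simp
  note grad = M.bilinear_grad[OF xs y0]
  have dims: "nvars ?P = ?n" "ncons ?P = ?n"
    by (simp_all add: bilinear_qp_def del: add_2_eq_Suc')
  let ?G = "{grad_x ?P (X i) (Y j) |i j. i < k \<and> j < k}" and ?H = "{grad_y ?P (X i) (Y j) |i j. i \<le> k \<and> j < k}"
  have G: "?G \<subseteq> carrier_vec ?n" and H: "?H \<subseteq> carrier_vec ?n"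
    unfolding grad_x_def grad_y_def grad_def dims by auto
  have Xk: "X k \<in> {x0 + d |d. d \<in> vspan ?n ?G}" and Yk: "Y k \<in> {y0 + d |d. d \<in> vspan ?n ?H}"
    using run init unfolding span_respecting_def dims by auto
  have X_carrier: "X k \<in> carrier_vec ?n" and Y_carrier: "Y k \<in> carrier_vec ?n"
    by (rule affine_span_coordinate[OF Xk x0 G] affine_span_coordinate[OF Yk y0 H])+
  have X_agree: "X k $ r = x0 $ r" if r: "r < ?n" "k \<le> r" for r
  proof (rule affine_span_coordinate(2)[OF Xk x0 G r(1)])
    fix v assume "v \<in> ?G"
    then obtain i j where ij: "i < k" "j < k" "v = grad_x ?P (X i) (Y j)" by auto
    have c: "X i \<in> carrier_vec ?n" "Y j \<in> carrier_vec ?n" using less[OF ij(1)] less[OF ij(2)] by auto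
    have "(Y j - y0) $ l = 0" if "r \<le> l" "l < ?n" for l
      using less[OF ij(2)] ij(2) r that y0 by simp
    then show "v $ r = 0"
      unfolding ij(3) grad(1)[OF c] using c y0 r(1) by (intro hard_matrix_transpose_index_eq_0) auto
  qed
  have "Y k $ r = y0 $ r" if r: "r < ?n" "k < r" for r
  proof (rule affine_span_coordinate(2)[OF Yk y0 H r(1)])
    fix v assume "v \<in> ?H"
    then obtain i j where ij: "i \<le> k" "j < k" "v = grad_y ?P (X i) (Y j)" by auto
    \<comment> \<open>The index \<open>i = k\<close> is allowed here and lies outside the induction
      hypothesis; it is covered by \<open>X_agree\<close>, just proved for the same
      \<open>k\<close>.\<close>
    have X: "X i \<in> carrier_vec ?n" "\<And>l. k \<le> l \<Longrightarrow> l < ?n \<Longrightarrow> X i $ l = x0 $ l"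
      using less[of i] ij(1) X_carrier X_agree by (cases "i = k"; force)+
    have c: "Y j \<in> carrier_vec ?n" using less[OF ij(2)] by auto
    show "v $ r = 0"
      unfolding ij(3) grad(2)[OF X(1) c] by (rule hard_matrix_residual_index[OF x0 X r(2,1)])
  qed
  then show ?case using X_carrier Y_carrier X_agree by blast
qed

text \<open>The gradient applies the matrix and then its transpose. Only the first factor activates
  a new index, so each iteration gains one coordinate. For the dual iterates only the dimension
  matters.\<close>

lemma least_squares_iterates_agree:
  assumes q: "0 < q" "q < 1" and x0: "x0 \<in> carrier_vec (N + 2)" and y0: "y0 \<in> carrier_vec 1"
    and run: "span_respecting (least_squares_qp (N + 2) (hard_matrix N q) (x0 + hard_solution N q)) X Y"
    and init: "X 0 = x0" "Y 0 = y0"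
  shows "X k \<in> carrier_vec (N + 2) \<and> Y k \<in> carrier_vec 1 \<and> (\<forall>j<N + 2. k \<le> j \<longrightarrow> X k $ j = x0 $ j)"
proof (induction k rule: less_induct)
  case (less k)
  let ?n = "N + 2" and ?A = "hard_matrix N q" and ?xs = "x0 + hard_solution N q"
  let ?P = "least_squares_qp ?n ?A ?xs"
  interpret M: bounded_below_matrix ?n ?A "1 - q" "1 + q" "unit_vec ?n N" "unit_vec ?n (N + 1)"
    using q by (intro hard_matrix_bounded_below) auto
  have xs: "?xs \<in> carrier_vec ?n" using x0 hard_solution_carrier[of N q] by simp
  have dims: "nvars ?P = ?n" "ncons ?P = 1"
    by (simp_all add: least_squares_qp_def del: add_2_eq_Suc')
  let ?G = "{grad_x ?P (X i) (Y j) |i j. i < k \<and> j < k}" and ?H = "{grad_y ?P (X i) (Y j) |i j. i \<le> k \<and> j < k}"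
  have G: "?G \<subseteq> carrier_vec ?n" and H: "?H \<subseteq> carrier_vec 1"
    unfolding grad_x_def grad_y_def grad_def dims by auto
  have Xk: "X k \<in> {x0 + d |d. d \<in> vspan ?n ?G}" and Yk: "Y k \<in> {y0 + d |d. d \<in> vspan 1 ?H}"
    using run init unfolding span_respecting_def dims by auto
  have X_carrier: "X k \<in> carrier_vec ?n" and Y_carrier: "Y k \<in> carrier_vec 1"
    by (rule affine_span_coordinate[OF Xk x0 G] affine_span_coordinate[OF Yk y0 H])+
  have "X k $ r = x0 $ r" if r: "r < ?n" "k \<le> r" for r
  proof (rule affine_span_coordinate(2)[OF Xk x0 G r(1)])
    fix v assume "v \<in> ?G"
    then obtain i j where ij: "i < k" "j < k" "v = grad_x ?P (X i) (Y j)" by auto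
    have X: "X i \<in> carrier_vec ?n" "\<And>l. i \<le> l \<Longrightarrow> l < ?n \<Longrightarrow> X i $ l = x0 $ l"
      and c: "Y j \<in> carrier_vec 1" using less[OF ij(1)] less[OF ij(2)] by auto
    have e: "X i - ?xs \<in> carrier_vec ?n" using X(1) xs by simp
    have zero: "(?A *\<^sub>v (X i - ?xs)) $ l = 0" if "r \<le> l" "l < ?n" for l
      using ij(1) r that by (intro hard_matrix_residual_index[OF x0 X]) auto
    show "v $ r = 0"
      unfolding ij(3) M.least_squares_grad_x[OF xs X(1) c]
      by (rule hard_matrix_transpose_index_eq_0[OF M.mult_carrier(1)[OF e] zero r(1)])
  qed
  then show ?case using X_carrier Y_carrier by blast
qed

section \<open>From geometric decay to the iteration count\<close>

lemma iteration_lower_bound: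
  fixes \<kappa> \<epsilon> q :: real
  assumes \<kappa>: "3 \<le> \<kappa>" and q: "q = (\<kappa> - sqrt 2) / (\<kappa> + sqrt 2)" and eps: "0 < \<epsilon>" and k: "(q\<^sup>2) ^ k \<le> \<epsilon>"
  shows "1 / 12 * \<kappa> * ln (1 / \<epsilon>) \<le> real k"
proof -
  have sqrt2: "0 < sqrt 2" "sqrt 2 < 3 / 2" by simp (rule real_less_lsqrt, simp_all add: power2_eq_square)
  have gap: "0 < \<kappa> - sqrt 2" "0 < \<kappa> + sqrt 2" using \<kappa> sqrt2 by linarith+
  have q0: "0 < q" unfolding q using gap by (rule divide_pos_pos)
  have "ln (1 / q) \<le> 1 / q - 1" using q0 by (intro ln_le_minus_one) simp
  also have "1 / q - 1 = 2 * sqrt 2 / (\<kappa> - sqrt 2)"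
    unfolding q using gap by (simp add: field_simps)
  also have "\<dots> \<le> 6 / \<kappa>"
  proof -
    \<comment> \<open>At \<open>\<kappa> = 3\<close> the required inequality reduces to
      \<open>sqrt 2 \<le> 3 / 2\<close>, and larger \<open>\<kappa>\<close> only helps.\<close>
    have "(6 - 2 * sqrt 2) * 3 \<le> (6 - 2 * sqrt 2) * \<kappa>"
      using \<kappa> sqrt2 by (intro mult_left_mono) auto
    then have "2 * sqrt 2 * \<kappa> \<le> 6 * (\<kappa> - sqrt 2)" using sqrt2 by (simp add: algebra_simps)
    then show ?thesis using \<kappa> gap by (simp add: field_simps)
  qed
  finally have lnq: "ln (1 / q) \<le> 6 / \<kappa>" .
  \<comment> \<open>The factor 2 from squaring \<open>q\<close> and the 6 in \<open>lnq\<close>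
    multiply to the 12 of the final constant.\<close>
  have "ln (q ^ (2 * k)) \<le> ln \<epsilon>"
    using k q0 eps by (simp add: power_mult)
  then have "ln (1 / \<epsilon>) \<le> 2 * real k * ln (1 / q)"
    using q0 eps by (simp add: ln_realpow ln_div)
  also have "\<dots> \<le> 2 * real k * (6 / \<kappa>)"
    using lnq by (intro mult_left_mono) auto
  finally show ?thesis using \<kappa> by (simp add: field_simps)
qed

lemma exists_geometric_small:
  fixes q \<epsilon> :: real
  assumes "0 < q" "q < 1" "0 < \<epsilon>"
  obtains N where "0 < N" "(q\<^sup>2) ^ N \<le> \<epsilon>"
proof -
  have q2: "q\<^sup>2 < 1" using power_sq_lt_1[OF assms(1,2), of 1] by simp
  then obtain N where "(q\<^sup>2) ^ N < \<epsilon>"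
    using real_arch_pow_inv assms(3) by blast
  \<comment> \<open>One extra power guarantees a positive exponent.\<close>
  then have "(q\<^sup>2) ^ Suc N \<le> \<epsilon>"
    using power_decreasing[of N "Suc N" "q\<^sup>2"] q2 by simp
  then show ?thesis using that by blast
qed

theorem theorem3:
  shows
    "(\<exists>C>0. \<exists>\<kappa>0::real. \<forall>\<kappa>\<ge>\<kappa>0. \<forall>\<epsilon>::real. 0 < \<epsilon> \<and> \<epsilon> < 1 \<longrightarrow>
       (\<exists>n>0. \<exists>m>0. \<forall>x0 \<in> carrier_vec n. \<forall>y0 \<in> carrier_vec m. \<exists>P.
          qp_instance n m P \<and> opt_dist P (x0, y0) = 1 \<and> saddle_points P \<noteq> {} \<and>
          (\<forall>\<xi>>0. \<exists>\<alpha>. quadratic_growth P \<xi> (feasible P) \<alpha>) \<and>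
          (INF \<xi>\<in>{0<..}. max (spectral_norm (amat P) / growth_constant P \<xi>)
                             (spectral_norm (amat P) / \<xi>)) = \<kappa> \<and>
          (\<forall>xs ys k. span_respecting P xs ys \<and> xs 0 = x0 \<and> ys 0 = y0 \<and>
             opt_dist P (xs k, ys k) \<le> \<epsilon> \<longrightarrow> C * \<kappa> * ln (1 / \<epsilon>) \<le> real k)))
     \<and>
     (\<exists>C>0. \<exists>\<kappa>0::real. \<forall>\<kappa>\<ge>\<kappa>0. \<forall>\<epsilon>::real. 0 < \<epsilon> \<and> \<epsilon> < 1 \<longrightarrow>
       (\<exists>n>0. \<exists>m>0. \<forall>x0 \<in> carrier_vec n. \<forall>y0 \<in> carrier_vec m. \<exists>P.
          qp_instance n m P \<and> opt_dist P (x0, y0) = 1 \<and> saddle_points P \<noteq> {} \<and>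
          (\<forall>\<xi>>0. \<exists>\<alpha>. quadratic_growth P \<xi> (feasible P) \<alpha>) \<and>
          (INF \<xi>\<in>{0<..}. max (sqrt (spectral_norm (qmat P) / growth_constant P \<xi>))
                             (sqrt (spectral_norm (qmat P) / \<xi>))) = \<kappa> \<and>
          (\<forall>xs ys k. span_respecting P xs ys \<and> xs 0 = x0 \<and> ys 0 = y0 \<and>
             opt_dist P (xs k, ys k) \<le> \<epsilon> \<longrightarrow> C * \<kappa> * ln (1 / \<epsilon>) \<le> real k)))"
proof -
  \<comment> \<open>\<open>q\<close> is the solution of
    \<open>sqrt 2 * (1 + q) / (1 - q) = \<kappa>\<close>, so the complexity measure is met exactly.
    \<open>N\<close>, and with it the dimension, is fixed by \<open>\<kappa>\<close> and
    \<open>\<epsilon>\<close> before the starting point is given.\<close>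
  have main: "\<exists>N q. 0 < N \<and> 0 < q \<and> q < 1 \<and> (q\<^sup>2) ^ N \<le> \<epsilon> / 2 \<and> q = (\<kappa> - sqrt 2) / (\<kappa> + sqrt 2) \<and>
      sqrt 2 * (1 + q) / (1 - q) = \<kappa>" if "3 \<le> \<kappa>" "0 < \<epsilon>" for \<kappa> \<epsilon> :: real
  proof -
    define q where "q = (\<kappa> - sqrt 2) / (\<kappa> + sqrt 2)"
    have sqrt2: "0 < sqrt 2" "sqrt 2 < 3 / 2" by simp (rule real_less_lsqrt, simp_all add: power2_eq_square)
    have gap: "0 < \<kappa> - sqrt 2" "0 < \<kappa> + sqrt 2" using that sqrt2 by linarith+
    have "0 < q" unfolding q_def using gap by (rule divide_pos_pos)
    moreover have "q < 1" unfolding q_def pos_divide_less_eq[OF gap(2)] using sqrt2 by simp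
    ultimately have q: "0 < q" "q < 1" by auto
    have "1 + q = 2 * \<kappa> / (\<kappa> + sqrt 2)" "1 - q = 2 * sqrt 2 / (\<kappa> + sqrt 2)"
      unfolding q_def using gap by (simp_all add: field_simps)
    then have "sqrt 2 * (1 + q) / (1 - q) = \<kappa>"
      using less_imp_neq[OF gap(2)] by simp
    moreover have "0 < \<epsilon> / 2" using that by simp
    then obtain N where "0 < N" "(q\<^sup>2) ^ N \<le> \<epsilon> / 2"
      using exists_geometric_small[OF q] by metis
    ultimately show ?thesis using q q_def by blast
  qed
  show ?thesis
  \<comment> \<open>The constant \<open>1 / 12\<close> and the threshold 3 come from
    \<open>iteration_lower_bound\<close> and serve both families.\<close>
  proof (intro conjI; rule exI[of _ "1 / 12"]; rule conjI; (rule exI[of _ 3], intro allI impI, elim conjE)?)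
    fix \<kappa> \<epsilon> :: real assume \<kappa>: "3 \<le> \<kappa>" and eps: "0 < \<epsilon>" "\<epsilon> < 1"
    obtain N q where N: "0 < N" "(q\<^sup>2) ^ N \<le> \<epsilon> / 2" and q: "0 < q" "q < 1"
      and q_eq: "q = (\<kappa> - sqrt 2) / (\<kappa> + sqrt 2)" and \<kappa>_eq: "sqrt 2 * (1 + q) / (1 - q) = \<kappa>"
      using main[OF \<kappa> eps(1)] by blast
    let ?n = "N + 2" and ?A = "hard_matrix N q" and ?w = "hard_solution N q"
    interpret M: bounded_below_matrix ?n ?A "1 - q" "1 + q" "unit_vec ?n N" "unit_vec ?n (N + 1)"
      using q by (intro hard_matrix_bounded_below) auto
    have start: "vnorm (x0 - (x0 + ?w)) = 1" if "x0 \<in> carrier_vec ?n" for x0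
    proof -
      have "x0 - (x0 + ?w) = - ?w"
        using that hard_solution_carrier[of N q] by (intro eq_vecI) auto
      then show ?thesis using hard_solution_norm[OF q N(1)] by simp
    qed
    have n: "?n > 0" and one: "(1 :: nat) > 0" by simp_all
    {
      fix x0 y0 :: "real vec" assume x0: "x0 \<in> carrier_vec ?n" and y0: "y0 \<in> carrier_vec ?n"
      let ?xs = "x0 + ?w"
      \<comment> \<open>The saddle point is placed relative to the start: the primal part is off by
        the unit vector \<open>?w\<close>, while the dual part starts at its optimum.\<close>
      let ?P = "bilinear_qp ?n ?A ?xs y0"
      have xs: "?xs \<in> carrier_vec ?n" using x0 hard_solution_carrier[of N q] by simp
      have "1 / 12 * \<kappa> * ln (1 / \<epsilon>) \<le> real k"
        if run: "span_respecting ?P X Y" "X 0 = x0" "Y 0 = y0" and acc: "opt_dist ?P (X k, Y k) \<le> \<epsilon>" for X Y k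
      proof (rule iteration_lower_bound[OF \<kappa> q_eq eps(1)])
        note agree = bilinear_iterates_agree[OF q x0 y0 run, of k]
        \<comment> \<open>Dropping the dual error only decreases the distance; the primal error
          alone yields the bound.\<close>
        have "vnorm (X k - ?xs) \<le> opt_dist ?P (X k, Y k)"
          unfolding M.bilinear_opt_dist[OF xs y0] pdist_def by (auto intro: real_le_rsqrt)
        then show "(q\<^sup>2) ^ k \<le> \<epsilon>"
          using agree acc by (intro hard_solution_dist[OF q N(2) eps x0, of "X k"]) auto
      qed
      moreover have "opt_dist ?P (x0, y0) = 1"
        unfolding M.bilinear_opt_dist[OF xs y0] pdist_def using start[OF x0] by simp
      ultimately have "\<exists>P. qp_instance ?n ?n P \<and> opt_dist P (x0, y0) = 1 \<and> saddle_points P \<noteq> {} \<and>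
          (\<forall>\<xi>>0. \<exists>\<alpha>. quadratic_growth P \<xi> (feasible P) \<alpha>) \<and>
          (INF \<xi>\<in>{0<..}. max (spectral_norm (amat P) / growth_constant P \<xi>)
                             (spectral_norm (amat P) / \<xi>)) = \<kappa> \<and>
          (\<forall>xs ys k. span_respecting P xs ys \<and> xs 0 = x0 \<and> ys 0 = y0 \<and>
             opt_dist P (xs k, ys k) \<le> \<epsilon> \<longrightarrow> 1 / 12 * \<kappa> * ln (1 / \<epsilon>) \<le> real k)"
        using M.bilinear_qp_instance[OF xs y0] M.bilinear_saddle_points[OF xs y0]
          M.bilinear_growth(1)[OF xs y0] M.bilinear_min_complexity[OF xs y0] \<kappa>_eq
        by (intro exI[of _ ?P]) blast
    }
    then show "\<exists>n>0. \<exists>m>0. \<forall>x0 \<in> carrier_vec n. \<forall>y0 \<in> carrier_vec m. \<exists>P.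
          qp_instance n m P \<and> opt_dist P (x0, y0) = 1 \<and> saddle_points P \<noteq> {} \<and>
          (\<forall>\<xi>>0. \<exists>\<alpha>. quadratic_growth P \<xi> (feasible P) \<alpha>) \<and>
          (INF \<xi>\<in>{0<..}. max (spectral_norm (amat P) / growth_constant P \<xi>)
                             (spectral_norm (amat P) / \<xi>)) = \<kappa> \<and>
          (\<forall>xs ys k. span_respecting P xs ys \<and> xs 0 = x0 \<and> ys 0 = y0 \<and>
             opt_dist P (xs k, ys k) \<le> \<epsilon> \<longrightarrow> 1 / 12 * \<kappa> * ln (1 / \<epsilon>) \<le> real k)"
      using n by blast
    {
      fix x0 y0 :: "real vec" assume x0: "x0 \<in> carrier_vec ?n" and y0: "y0 \<in> carrier_vec 1"
      let ?xs = "x0 + ?w"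
      \<comment> \<open>Again the primal optimum lies at \<open>?w\<close> from the start; every
        dual start is optimal, so \<open>y0\<close> does not enter the instance.\<close>
      let ?P = "least_squares_qp ?n ?A ?xs"
      have xs: "?xs \<in> carrier_vec ?n" using x0 hard_solution_carrier[of N q] by simp
      have "1 / 12 * \<kappa> * ln (1 / \<epsilon>) \<le> real k"
        if run: "span_respecting ?P X Y" "X 0 = x0" "Y 0 = y0" and acc: "opt_dist ?P (X k, Y k) \<le> \<epsilon>" for X Y k
      proof (rule iteration_lower_bound[OF \<kappa> q_eq eps(1)])
        note agree = least_squares_iterates_agree[OF q x0 y0 run, of k]
        have "Y k \<in> carrier_vec 1" using agree by blast
        then have "vnorm (X k - ?xs) \<le> \<epsilon>"
          using acc by (simp only: M.least_squares_opt_dist[OF xs])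
        then show "(q\<^sup>2) ^ k \<le> \<epsilon>"
          using agree by (intro hard_solution_dist[OF q N(2) eps x0, of "X k"]) auto
      qed
      moreover have "opt_dist ?P (x0, y0) = 1"
        unfolding M.least_squares_opt_dist[OF xs y0] by (rule start[OF x0])
      moreover have "saddle_points ?P \<noteq> {}"
        unfolding M.least_squares_saddle_points[OF xs] using y0 by blast
      ultimately have "\<exists>P. qp_instance ?n 1 P \<and> opt_dist P (x0, y0) = 1 \<and> saddle_points P \<noteq> {} \<and>
          (\<forall>\<xi>>0. \<exists>\<alpha>. quadratic_growth P \<xi> (feasible P) \<alpha>) \<and>
          (INF \<xi>\<in>{0<..}. max (sqrt (spectral_norm (qmat P) / growth_constant P \<xi>))
                             (sqrt (spectral_norm (qmat P) / \<xi>))) = \<kappa> \<and>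
          (\<forall>xs ys k. span_respecting P xs ys \<and> xs 0 = x0 \<and> ys 0 = y0 \<and>
             opt_dist P (xs k, ys k) \<le> \<epsilon> \<longrightarrow> 1 / 12 * \<kappa> * ln (1 / \<epsilon>) \<le> real k)"
        using M.least_squares_instance[OF xs] M.least_squares_growth(1)[OF xs]
          M.least_squares_min_complexity[OF xs] \<kappa>_eq
        by (intro exI[of _ ?P]) blast
    }
    then show "\<exists>n>0. \<exists>m>0. \<forall>x0 \<in> carrier_vec n. \<forall>y0 \<in> carrier_vec m. \<exists>P.
          qp_instance n m P \<and> opt_dist P (x0, y0) = 1 \<and> saddle_points P \<noteq> {} \<and>
          (\<forall>\<xi>>0. \<exists>\<alpha>. quadratic_growth P \<xi> (feasible P) \<alpha>) \<and>
          (INF \<xi>\<in>{0<..}. max (sqrt (spectral_norm (qmat P) / growth_constant P \<xi>))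
                             (sqrt (spectral_norm (qmat P) / \<xi>))) = \<kappa> \<and>
          (\<forall>xs ys k. span_respecting P xs ys \<and> xs 0 = x0 \<and> ys 0 = y0 \<and>
             opt_dist P (xs k, ys k) \<le> \<epsilon> \<longrightarrow> 1 / 12 * \<kappa> * ln (1 / \<epsilon>) \<le> real k)"
      using n one by blast
  qed simp_all
qed

end
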